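(* Let $\Sigma$ be the structurally well-posed $n\times n$ signature matrix of a DAE. (i) The set of normalised offset vectors of $\Sigma$ has more than one member if and only if the fine-block graph of $\Sigma$ has more than one vertex, i.e. if and only if the DAE is fine-block reducible. (ii) The set of normalised offset vectors of $\Sigma$ is infinite if and only if the fine-block graph of $\Sigma$ has more than one strong component, i.e. if and only if the DAE is coarse-block reducible.
   Context: A signature matrix is an $n\times n$ matrix $\Sigma=(\sigma_{ij})$ with entries in $\mathbb{Z}_{\ge0}\cup\{-\infty\}$ (for a DAE $f_i=0$ in variables $x_j$, $\sigma_{ij}$ is the order of the highest derivative of $x_j$ occurring in $f_i$, or $-\infty$ if none; all notions below depend only on $\Sigma$). A transversal is a set $T$ of $n$ positions $(i,j)$ with exactly one in each row and each column; its value is $\sum_{(i,j)\in T}\sigma_{ij}$. $\Sigma$ is structurally well-posed if it has a transversal on which all $\sigma_{ij}$ are finite. A highest-value transversal (HVT) is a transversal of maximal value. The essential sparsity pattern $S_{\mathrm{ess}}$ is the union of all HVTs of $\Sigma$. The sparsity pattern of $\Sigma$ is $S=\{(i,j):\sigma_{ij}>-\infty\}$. A normalised offset vector of $\Sigma$ is a pair $(c,d)$ of integer $n$-vectors with $\min_i c_i=0$, $d_j-c_i\ge\sigma_{ij}$ for all $i,j$, and $d_j-c_i=\sigma_{ij}$ for all $(i,j)$ on some HVT (equivalently, on every HVT). A permuted square-block form consists of permutations $\rho$ (of rows) and $\kappa$ (of columns) of $\{1,\ldots,n\}$ and positive integers $N_1,\ldots,N_p$ summing to $n$; put $B_l=\{i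 : \sum_{r<l}N_r < i\le \sum_{r\le l}N_r\}$, $R_l=\rho(B_l)$, $C_l=\kappa(B_l)$. It puts a pattern $A\subseteq\{1,\ldots,n\}^2$ into (upper) block-triangular form (BTF) if $A\cap(R_k\times C_l)=\emptyset$ whenever $k>l$. A pattern containing a transversal is irreducible if no such form with $p>1$ puts it into BTF. A BTF is irreducible if each diagonal sub-pattern $A\cap(R_l\times C_l)$ is irreducible (as an $N_l\times N_l$ pattern). Every pattern containing a transversal has an irreducible BTF, and the set of pairs $\{(R_1,C_1),\ldots,(R_p,C_p)\}$ is the same for every irreducible BTF of $A$; it is called the irreducible emblem of $A$. The fine blocks of $\Sigma$ (or the DAE) are the pairs in the irreducible emblem of $S_{\mathrm{ess}}$ (which equals the irreducible emblem of $\{(i,j):d_j-c_i=\sigma_{ij}\}$ for every normalised offset vector $(c,d)$). The coarse blocks are the pairs in the irreducible emblem of $S$. The DAE is fine-block (respectively coarse-block) reducible if it has more than one fine (respectively coarse) block. The fine-block graph of $\Sigma$ (ignoring its edge weights, which are irrelevant to the statement) is the digraph whose vertices are the fine blocks, enumerated $(R_1,C_1),\ldots,(R_p,C_p)$ in some order, with an edge $k\to l$ for each pair $k\ne l$ with $S\cap(R_k\times C_l)\ne\emptyset$. Strong components of a digraph are the equivalence classes of vertices under mutual reachability by directed paths (zero-length paths allowed). *)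

theory Defs
  imports "HOL-Analysis.Analysis"
begin

text \<open>
  An \<open>n \<times> n\<close> matrix is indexed by a finite type \<open>'n\<close>. Types are nonempty, so \<open>n \<ge> 1\<close>; this is
  needed for \<open>min\<^sub>i c\<^sub>i\<close> to make sense.
\<close>

definition more_than_one :: "'a set \<Rightarrow> bool" where
  "more_than_one X \<longleftrightarrow> (\<exists>x\<in>X. \<exists>y\<in>X. x \<noteq> y)"


subsection \<open>Signature matrices, transversals and offsets\<close>

definition signature_matrix :: "ereal ^ 'n ^ 'n \<Rightarrow> bool" where
  "signature_matrix \<Sigma> \<longleftrightarrow> (\<forall>i j. \<Sigma> $ i $ j = -\<infinity> \<or> (\<exists>k::nat. \<Sigma> $ i $ j = ereal (real k)))"

definition sparsity_pattern :: "ereal ^ 'n ^ 'n \<Rightarrow> ('n \<times> 'n) set" where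
  "sparsity_pattern \<Sigma> = {(i, j). \<Sigma> $ i $ j > -\<infinity>}"

text \<open>
  Transversals and block forms are defined relative to a row set \<open>R\<close> and a column set \<open>C\<close>, because
  they are also applied to the diagonal sub-patterns of a block form. The full matrix is the case
  \<open>R = C = UNIV\<close>.
\<close>

definition transversal :: "'a set \<Rightarrow> 'b set \<Rightarrow> ('a \<times> 'b) set \<Rightarrow> bool" where
  "transversal R C T \<longleftrightarrow>
     T \<subseteq> R \<times> C \<and> (\<forall>i\<in>R. \<exists>!j. (i, j) \<in> T) \<and> (\<forall>j\<in>C. \<exists>!i. (i, j) \<in> T)"

definition transversal_value :: "ereal ^ 'n ^ 'n \<Rightarrow> ('n \<times> 'n) set \<Rightarrow> ereal" where
  "transversal_value \<Sigma> T = (\<Sum>(i, j)\<in>T. \<Sigma> $ i $ j)"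

definition structurally_well_posed :: "ereal ^ 'n ^ 'n \<Rightarrow> bool" where
  "structurally_well_posed \<Sigma> \<longleftrightarrow>
     (\<exists>T. transversal UNIV UNIV T \<and> (\<forall>(i, j)\<in>T. \<bar>\<Sigma> $ i $ j\<bar> \<noteq> \<infinity>))"

definition highest_value_transversal :: "ereal ^ 'n ^ 'n \<Rightarrow> ('n \<times> 'n) set \<Rightarrow> bool" where
  "highest_value_transversal \<Sigma> T \<longleftrightarrow>
     transversal UNIV UNIV T \<and>
     (\<forall>T'. transversal UNIV UNIV T' \<longrightarrow> transversal_value \<Sigma> T' \<le> transversal_value \<Sigma> T)"

definition essential_sparsity_pattern :: "ereal ^ 'n ^ 'n \<Rightarrow> ('n \<times> 'n) set" where
  "essential_sparsity_pattern \<Sigma> = \<Union> {T. highest_value_transversal \<Sigma> T}"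

definition normalised_offset_vectors :: "ereal ^ 'n ^ 'n \<Rightarrow> ((int ^ 'n) \<times> (int ^ 'n)) set" where
  "normalised_offset_vectors \<Sigma> =
     {(c, d). Min (range (\<lambda>i. c $ i)) = 0 \<and>
        (\<forall>i j. ereal (real_of_int (d $ j - c $ i)) \<ge> \<Sigma> $ i $ j) \<and>
        (\<exists>T. highest_value_transversal \<Sigma> T \<and>
             (\<forall>(i, j)\<in>T. ereal (real_of_int (d $ j - c $ i)) = \<Sigma> $ i $ j))}"


subsection \<open>Block-triangular forms\<close>

text \<open>
  The sizes \<open>N\<^sub>1, \<dots>, N\<^sub>p\<close> are a list \<open>N\<close> with \<open>p = length N\<close>; blocks are numbered from \<open>0\<close>, while the
  positions inside the permuted matrix run through \<open>{1..sum_list N}\<close>. The bijections below force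
  \<open>sum_list N = card R = card C\<close> when \<open>R\<close> and \<open>C\<close> are finite. With \<open>R = C = UNIV\<close>, \<open>\<rho>\<close> and \<open>\<kappa>\<close> are
  the row and column permutations, up to naming the indices \<open>1, \<dots>, n\<close>.
\<close>

definition block_positions :: "nat list \<Rightarrow> nat \<Rightarrow> nat set" where
  "block_positions N l = {i. sum_list (take l N) < i \<and> i \<le> sum_list (take (Suc l) N)}"

definition square_block_form ::
    "'a set \<Rightarrow> 'b set \<Rightarrow> (nat \<Rightarrow> 'a) \<Rightarrow> (nat \<Rightarrow> 'b) \<Rightarrow> nat list \<Rightarrow> bool" where
  "square_block_form R C \<rho> \<kappa> N \<longleftrightarrow>
     bij_betw \<rho> {1..sum_list N} R \<and> bij_betw \<kappa> {1..sum_list N} C \<and> (\<forall>m\<in>set N. m > 0)"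

definition puts_into_btf ::
    "('a \<times> 'b) set \<Rightarrow> (nat \<Rightarrow> 'a) \<Rightarrow> (nat \<Rightarrow> 'b) \<Rightarrow> nat list \<Rightarrow> bool" where
  "puts_into_btf A \<rho> \<kappa> N \<longleftrightarrow>
     (\<forall>k<length N. \<forall>l<length N. k > l \<longrightarrow>
        A \<inter> (\<rho> ` block_positions N k \<times> \<kappa> ` block_positions N l) = {})"

definition irreducible_pattern :: "'a set \<Rightarrow> 'b set \<Rightarrow> ('a \<times> 'b) set \<Rightarrow> bool" where
  "irreducible_pattern R C A \<longleftrightarrow>
     (\<exists>T\<subseteq>A. transversal R C T) \<and>
     \<not> (\<exists>\<rho> \<kappa> N. square_block_form R C \<rho> \<kappa> N \<and> length N > 1 \<and> puts_into_btf A \<rho> \<kappa> N)"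

definition irreducible_btf ::
    "('n \<times> 'n) set \<Rightarrow> (nat \<Rightarrow> 'n) \<Rightarrow> (nat \<Rightarrow> 'n) \<Rightarrow> nat list \<Rightarrow> bool" where
  "irreducible_btf A \<rho> \<kappa> N \<longleftrightarrow>
     square_block_form UNIV UNIV \<rho> \<kappa> N \<and> puts_into_btf A \<rho> \<kappa> N \<and>
     (\<forall>l<length N.
        let R = \<rho> ` block_positions N l; C = \<kappa> ` block_positions N l
        in irreducible_pattern R C (A \<inter> (R \<times> C)))"

definition emblem :: "(nat \<Rightarrow> 'a) \<Rightarrow> (nat \<Rightarrow> 'b) \<Rightarrow> nat list \<Rightarrow> ('a set \<times> 'b set) set" where
  "emblem \<rho> \<kappa> N = (\<lambda>l. (\<rho> ` block_positions N l, \<kappa> ` block_positions N l)) ` {..<length N}"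

text \<open>
  Well defined for every pattern that contains a transversal: an irreducible BTF then exists, and all
  of them have the same emblem.
\<close>

definition irreducible_emblem :: "('n \<times> 'n) set \<Rightarrow> ('n set \<times> 'n set) set" where
  "irreducible_emblem A = (THE E. \<exists>\<rho> \<kappa> N. irreducible_btf A \<rho> \<kappa> N \<and> E = emblem \<rho> \<kappa> N)"


subsection \<open>Fine and coarse blocks, fine-block graph\<close>

definition fine_blocks :: "ereal ^ 'n ^ 'n \<Rightarrow> ('n set \<times> 'n set) set" where
  "fine_blocks \<Sigma> = irreducible_emblem (essential_sparsity_pattern \<Sigma>)"

definition coarse_blocks :: "ereal ^ 'n ^ 'n \<Rightarrow> ('n set \<times> 'n set) set" where
  "coarse_blocks \<Sigma> = irreducible_emblem (sparsity_pattern \<Sigma>)"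

definition fine_block_reducible :: "ereal ^ 'n ^ 'n \<Rightarrow> bool" where
  "fine_block_reducible \<Sigma> \<longleftrightarrow> more_than_one (fine_blocks \<Sigma>)"

definition coarse_block_reducible :: "ereal ^ 'n ^ 'n \<Rightarrow> bool" where
  "coarse_block_reducible \<Sigma> \<longleftrightarrow> more_than_one (coarse_blocks \<Sigma>)"

text \<open>
  A digraph is a pair of a vertex set and an edge relation. The blocks themselves serve as the vertices
  of the fine-block graph, so that no enumeration of them has to be chosen.
\<close>

type_synonym 'v digraph = "'v set \<times> ('v \<times> 'v) set"

definition vertices :: "'v digraph \<Rightarrow> 'v set" where
  "vertices G = fst G"

definition edges :: "'v digraph \<Rightarrow> ('v \<times> 'v) set" where
  "edges G = snd G"

definition strong_components :: "'v digraph \<Rightarrow> 'v set set" where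
  "strong_components G =
     vertices G // {(u, v). u \<in> vertices G \<and> v \<in> vertices G \<and>
                            (u, v) \<in> (edges G)\<^sup>* \<and> (v, u) \<in> (edges G)\<^sup>*}"

definition fine_block_graph :: "ereal ^ 'n ^ 'n \<Rightarrow> ('n set \<times> 'n set) digraph" where
  "fine_block_graph \<Sigma> =
     (fine_blocks \<Sigma>,
      {((R, C), (R', C')). (R, C) \<in> fine_blocks \<Sigma> \<and> (R', C') \<in> fine_blocks \<Sigma> \<and>
         (R, C) \<noteq> (R', C') \<and> sparsity_pattern \<Sigma> \<inter> (R \<times> C') \<noteq> {}})"

end

theory Submission
  imports Defs "HOL-Combinatorics.Cycles"
begin

text \<open>
  Fix an HVT, given by a bijection \<open>\<pi>\<close> from rows to columns, and attach to a pattern \<open>A\<close> the digraph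
  on rows with an edge \<open>i \<rightarrow> k\<close> whenever \<open>(i, \<pi> k) \<in> A\<close>. The blocks of the irreducible emblem of \<open>A\<close> are
  then the pairs \<open>(K, \<pi> ` K)\<close> for the strong components \<open>K\<close> of this digraph. Eliminating \<open>d\<close> turns the
  offset vectors into solutions \<open>c\<close> of difference constraints \<open>c i + w i k \<le> c k\<close> along the edges of
  the digraph \<open>D\<close> of \<open>S\<close>; maximality of \<open>\<pi>\<close> says that there is no cycle of positive weight, so
  heaviest paths give a solution. The zero-weight cycles are those that turn \<open>\<pi>\<close> into another HVT;
  their edges form the digraph of the essential sparsity pattern and are tight for every solution.
  If \<open>D\<close> is strongly connected, paths bound all differences of a solution; otherwise \<open>c\<close> can be raised
  arbitrarily on a set that no edge leaves. If the essential digraph is strongly connected, the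
  differences are determined; otherwise some proper nonempty set is left by no tight
  edge, and \<open>c\<close> can be raised by 1 there.
\<close>

subsection \<open>Systems of difference constraints\<close>

definition potential :: "('a \<times> 'a) set \<Rightarrow> ('a \<Rightarrow> 'a \<Rightarrow> int) \<Rightarrow> ('a \<Rightarrow> int) \<Rightarrow> bool" where
  "potential D w c \<longleftrightarrow> (\<forall>(i, j)\<in>D. c i + w i j \<le> c j)"

lemma potentialD: "potential D w c \<Longrightarrow> (i, j) \<in> D \<Longrightarrow> c i + w i j \<le> c j"
  by (auto simp: potential_def)

definition normalised_potentials ::
    "('a \<times> 'a) set \<Rightarrow> ('a \<Rightarrow> 'a \<Rightarrow> int) \<Rightarrow> ('a \<Rightarrow> int) set" where
  "normalised_potentials D w = {c. potential D w c \<and> Min (range c) = 0}"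

text \<open>A covering of all vertices by disjoint cycles, loops included. In the application these
  correspond to the finite transversals.\<close>

definition permutation_in :: "('a \<times> 'a) set \<Rightarrow> ('a \<Rightarrow> 'a) \<Rightarrow> bool" where
  "permutation_in D \<tau> \<longleftrightarrow> bij \<tau> \<and> (\<forall>i. (i, \<tau> i) \<in> D)"

text \<open>With zero-weight loops everywhere and no permutation of positive weight, these are the
  edges on zero-weight cycles. Encoding them by whole permutations matches transversals
  directly.\<close>

definition zero_weight_edges ::
    "('a::finite \<times> 'a) set \<Rightarrow> ('a \<Rightarrow> 'a \<Rightarrow> int) \<Rightarrow> ('a \<times> 'a) set" where
  "zero_weight_edges D w = {(i, \<tau> i) |i \<tau>. permutation_in D \<tau> \<and> (\<Sum>k\<in>UNIV. w k (\<tau> k)) = 0}"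

section \<open>Paths, cycles and the permutations they induce\<close>

fun path_weight :: "('a \<Rightarrow> 'a \<Rightarrow> int) \<Rightarrow> 'a list \<Rightarrow> int" where
  "path_weight w (x # y # xs) = w x y + path_weight w (y # xs)"
| "path_weight w xs = 0"

lemma path_weight_append: "path_weight w (xs @ y # ys) = path_weight w (xs @ [y]) + path_weight w (y # ys)"
  by (induction xs rule: induct_list012) auto

lemma path_weight_snoc:
  "xs \<noteq> [] \<Longrightarrow> path_weight w (xs @ [y]) = path_weight w xs + w (last xs) y"
  by (induction xs rule: induct_list012) auto

lemma potential_path:
  assumes "potential D w c" "xs \<noteq> []" "successively (\<lambda>x y. (x, y) \<in> D) xs"
  shows "c (hd xs) + path_weight w xs \<le> c (last xs)"
  using assms(2,3)
proof (induction xs rule: induct_list012)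
  case (3 x y zs)
  then have "c x + w x y \<le> c y"
    using assms(1) by (auto simp: potential_def)
  with 3 show ?case by auto
qed auto

text \<open>A repeated vertex is removed by a shortcut. Distinctness is what later lets a closed
  path be read as a permutation.\<close>

lemma rtrancl_imp_distinct_path:
  assumes "(x, y) \<in> D\<^sup>*"
  shows "\<exists>xs. distinct xs \<and> xs \<noteq> [] \<and> hd xs = x \<and> last xs = y \<and> successively (\<lambda>x y. (x, y) \<in> D) xs"
  using assms
proof (induction rule: converse_rtrancl_induct)
  case base
  show ?case by (rule exI[of _ "[y]"]) auto
next
  case (step x z)
  then obtain xs where xs: "distinct xs" "xs \<noteq> []" "hd xs = z" "last xs = y"
    "successively (\<lambda>x y. (x, y) \<in> D) xs" by blast
  show ?case
  proof (cases "x \<in> set xs")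
    case False
    then show ?thesis
      using xs step by (intro exI[of _ "x # xs"]) (auto simp: successively_Cons)
  next
    case True
    then obtain ys zs where "xs = ys @ x # zs" by (auto simp: in_set_conv_decomp)
    then show ?thesis
      using xs by (intro exI[of _ "x # zs"]) (auto simp: successively_append_iff)
  qed
qed

text \<open>The endpoint \<open>z\<close> is kept free so that the induction can move the head; a
  cycle is the case \<open>z = hd xs\<close>.\<close>

lemma rotated_path:
  assumes "xs \<noteq> []" "map f xs = tl xs @ [z]"
    "successively (\<lambda>x y. (x, y) \<in> D) xs" "(last xs, z) \<in> D"
  shows "(\<forall>x\<in>set xs. (x, f x) \<in> D) \<and> path_weight w (xs @ [z]) = (\<Sum>x\<leftarrow>xs. w x (f x)) \<and> f (last xs) = z"
  using assms by (induction xs rule: induct_list012) auto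

text \<open>Rotate the vertices of the cycle and fix all others: fixed vertices use loops of
  \<open>D\<close>, which weigh nothing.\<close>

lemma cycle_imp_permutation:
  fixes D :: "('a::finite \<times> 'a) set"
  assumes xs: "distinct xs" "xs \<noteq> []" "successively (\<lambda>x y. (x, y) \<in> D) xs" "(last xs, hd xs) \<in> D"
    and "refl D" and w: "\<And>i. w i i = 0"
  shows "\<exists>\<tau>. permutation_in D \<tau> \<and> \<tau> (last xs) = hd xs \<and>
           (\<Sum>i\<in>UNIV. w i (\<tau> i)) = path_weight w (xs @ [hd xs])"
proof -
  define \<tau> where "\<tau> = cycle_of_list xs"
  have "map \<tau> xs = tl xs @ [hd xs]"
    using cyclic_rotation[OF xs(1), of 1] xs(2) by (simp add: \<tau>_def rotate1_hd_tl)
  note rot = rotated_path[OF xs(2) this xs(3,4), of w]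
  have out: "\<tau> i = i" if "i \<notin> set xs" for i
    using that by (simp add: \<tau>_def id_outside_supp)
  have "bij \<tau>"
    unfolding \<tau>_def using cycle_permutes permutes_bij by blast
  moreover have "(i, \<tau> i) \<in> D" for i
    using rot out[of i] \<open>refl D\<close> by (cases "i \<in> set xs") (auto simp: refl_on_def)
  moreover have "(\<Sum>i\<in>UNIV. w i (\<tau> i)) = (\<Sum>i\<in>set xs. w i (\<tau> i))"
    by (rule sum.mono_neutral_right) (auto simp: out w)
  ultimately show ?thesis
    using rot xs(1) by (intro exI[of _ \<tau>]) (auto simp: permutation_in_def sum_list_distinct_conv_sum_set)
qed

text \<open>\<open>c i\<close> is the weight of a heaviest simple path ending in \<open>i\<close>.
  There are finitely many simple paths, and a cycle closed by a further edge can be cut off because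
  no cycle has positive weight.\<close>

lemma exists_potential:
  fixes D :: "('a::finite \<times> 'a) set"
  assumes "refl D" and w: "\<And>i. w i i = 0"
    and nonpos: "\<And>\<tau>. permutation_in D \<tau> \<Longrightarrow> (\<Sum>i\<in>UNIV. w i (\<tau> i)) \<le> 0"
  shows "\<exists>c. potential D w c"
proof -
  define P where "P i = {xs. distinct xs \<and> xs \<noteq> [] \<and> last xs = i \<and>
    successively (\<lambda>x y. (x, y) \<in> D) xs}" for i
  define c where "c i = Max (path_weight w ` P i)" for i
  have "P i \<subseteq> {xs. set xs \<subseteq> UNIV \<and> distinct xs}" for i
    by (auto simp: P_def)
  then have fin: "finite (P i)" for i
    by (rule finite_subset) (rule finite_subset_distinct[OF finite])
  have ge: "path_weight w xs \<le> c i" if "xs \<in> P i" for xs i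
    unfolding c_def using fin that by auto
  have "\<exists>xs\<in>P i. c i = path_weight w xs" for i
  proof -
    have "[i] \<in> P i" by (auto simp: P_def)
    then have "c i \<in> path_weight w ` P i"
      unfolding c_def using fin by (intro Max_in) auto
    then show ?thesis by auto
  qed
  note attained = this
  have "c i + w i j \<le> c j" if ij: "(i, j) \<in> D" for i j
  proof -
    obtain xs where xs: "xs \<in> P i" "c i = path_weight w xs" using attained by blast
    then have eq: "c i + w i j = path_weight w (xs @ [j])"
      by (auto simp: P_def path_weight_snoc)
    show ?thesis
    proof (cases "j \<in> set xs")
      case False
      then have "xs @ [j] \<in> P j"
        using xs(1) ij by (auto simp: P_def successively_append_iff)
      then show ?thesis using ge eq by metis
    next
      case True
      \<comment> \<open>The edge to \<open>j\<close> closes a cycle. The walk splits at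
        \<open>j\<close> into a simple path, bounded by \<open>c j\<close>, and a cycle of weight at
        most 0.\<close>
      then obtain ys zs where yz: "xs = ys @ j # zs" by (auto simp: in_set_conv_decomp)
      then have "ys @ [j] \<in> P j"
        using xs(1) by (auto simp: P_def successively_append_iff)
      then have "path_weight w (ys @ [j]) \<le> c j" by (rule ge)
      moreover have "\<exists>\<tau>. permutation_in D \<tau> \<and> \<tau> (last (j # zs)) = hd (j # zs) \<and>
           (\<Sum>i\<in>UNIV. w i (\<tau> i)) = path_weight w ((j # zs) @ [hd (j # zs)])"
        using xs(1) ij yz assms(1) w
        by (intro cycle_imp_permutation) (auto simp: P_def successively_append_iff)
      then have "path_weight w (j # zs @ [j]) \<le> 0" using nonpos by force
      ultimately show ?thesis
        using eq yz path_weight_append[of w ys j "zs @ [j]"] by simp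
    qed
  qed
  then show ?thesis by (auto simp: potential_def)
qed

text \<open>Summed over a permutation, the slacks telescope to minus its total weight, which is 0;
  nonnegative slacks with sum 0 all vanish.\<close>

lemma potential_tight:
  fixes D :: "('a::finite \<times> 'a) set"
  assumes "potential D w c" "(i, j) \<in> zero_weight_edges D w"
  shows "c j = c i + w i j"
proof -
  obtain \<tau> where \<tau>: "permutation_in D \<tau>" "(\<Sum>k\<in>UNIV. w k (\<tau> k)) = 0" "j = \<tau> i"
    using assms(2) by (auto simp: zero_weight_edges_def)
  have nonneg: "c (\<tau> k) - c k - w k (\<tau> k) \<ge> 0" for k
    using potentialD[OF assms(1), of k "\<tau> k"] \<tau>(1) by (auto simp: permutation_in_def)
  have "(\<Sum>k\<in>UNIV. c (\<tau> k)) = (\<Sum>k\<in>UNIV. c k)"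
    using \<tau>(1) by (intro sum.reindex_bij_betw) (auto simp: permutation_in_def)
  then have "(\<Sum>k\<in>UNIV. c (\<tau> k) - c k - w k (\<tau> k)) = 0"
    using \<tau>(2) by (simp add: sum_subtractf)
  then have "c (\<tau> i) - c i - w i (\<tau> i) = 0"
    using nonneg by (subst (asm) sum_nonneg_eq_0_iff) auto
  then show ?thesis using \<tau>(3) by simp
qed

definition tight_edges where
  "tight_edges D w c = {(i, j) \<in> D. c j = c i + w i j}"

text \<open>The tight path back closes the edge to a cycle. On tight edges the weight is a
  difference of \<open>c\<close>, so the weights along a permutation cancel.\<close>

lemma tight_cycle_zero_weight:
  fixes D :: "('a::finite \<times> 'a) set"
  assumes "refl D" and w: "\<And>i. w i i = 0"
    and ij: "(i, j) \<in> tight_edges D w c" and ji: "(j, i) \<in> (tight_edges D w c)\<^sup>*"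
  shows "(i, j) \<in> zero_weight_edges D w"
proof -
  let ?T = "tight_edges D w c"
  obtain xs where xs: "distinct xs" "xs \<noteq> []" "hd xs = j" "last xs = i"
    "successively (\<lambda>x y. (x, y) \<in> ?T) xs"
    using rtrancl_imp_distinct_path[OF ji] by blast
  \<comment> \<open>Loops are tight because they weigh 0, so the cycle extends to a permutation by
    tight edges alone.\<close>
  have "refl ?T"
    using assms(1) w by (auto simp: refl_on_def tight_edges_def)
  then obtain \<tau> where \<tau>: "permutation_in ?T \<tau>" "\<tau> i = j"
    using cycle_imp_permutation[of xs ?T w] xs ij w by auto
  have "w k (\<tau> k) = c (\<tau> k) - c k" for k
    using \<tau>(1) by (auto simp: permutation_in_def tight_edges_def)
  then have "(\<Sum>k\<in>UNIV. w k (\<tau> k)) = (\<Sum>k\<in>UNIV. c (\<tau> k)) - (\<Sum>k\<in>UNIV. c k)"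
    by (simp add: sum_subtractf)
  also have "(\<Sum>k\<in>UNIV. c (\<tau> k)) = (\<Sum>k\<in>UNIV. c k)"
    using \<tau>(1) by (intro sum.reindex_bij_betw) (auto simp: permutation_in_def)
  finally show ?thesis
    using \<tau> by (force simp: zero_weight_edges_def permutation_in_def tight_edges_def)
qed

section \<open>Normalised solutions and their number\<close>

lemma normalise_potential:
  fixes c :: "'a::finite \<Rightarrow> int"
  assumes "potential D w c"
  shows "(\<lambda>i. c i - Min (range c)) \<in> normalised_potentials D w"
proof -
  have "Min (range (\<lambda>i. c i + - Min (range c))) = Min (range c) + - Min (range c)"
    by (rule Min_add_commute) auto
  then have "Min (range (\<lambda>i. c i - Min (range c))) = 0"
    by (simp only: diff_conv_add_uminus add.right_inverse)
  then show ?thesis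
    using assms by (auto simp: normalised_potentials_def potential_def)
qed

lemma Min_range_attained: "\<exists>x. f x = Min (range (f :: 'a::finite \<Rightarrow> int))"
  using Min_in[of "range f"] by fastforce

text \<open>Equal differences leave only a constant shift, which the common minimum
  excludes.\<close>

lemma normalised_potential_eqI:
  fixes c :: "'a::finite \<Rightarrow> int"
  assumes "Min (range c) = 0" "Min (range c') = 0" and eq: "\<And>x y. c y - c x = c' y - c' x"
  shows "c = c'"
proof -
  obtain x where x: "c x = 0"
    using assms(1) Min_range_attained[of c] by auto
  have "c y = c' y + - c' x" for y using eq[of x y] x by simp
  then have "c = (\<lambda>y. c' y + - c' x)" by auto
  moreover have "Min (range (\<lambda>y. c' y + - c' x)) = Min (range c') + - c' x"
    by (rule Min_add_commute) auto
  ultimately show ?thesis using assms by simp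
qed

text \<open>The vertices reachable from \<open>x\<close> form such a set. Raising a solution on a
  set that no edge leaves keeps it a solution.\<close>

lemma proper_closed_set:
  assumes "D\<^sup>* \<noteq> UNIV"
  shows "\<exists>K x y. x \<in> K \<and> y \<notin> K \<and> (\<forall>(i, j)\<in>D. i \<in> K \<longrightarrow> j \<in> K)"
proof -
  obtain x y where "(x, y) \<notin> D\<^sup>*" using assms by auto
  then show ?thesis
    by (intro exI[of _ "D\<^sup>* `` {x}"] exI[of _ x] exI[of _ y]) (auto intro: rtrancl_into_rtrancl)
qed

text \<open>The weight of a path from \<open>x\<close> to \<open>y\<close> serves as
  \<open>m\<close>; the point is that it does not depend on \<open>c\<close>.\<close>

lemma potential_diff_le:
  assumes "(x, y) \<in> D\<^sup>*"
  shows "\<exists>m. \<forall>c. potential D w c \<longrightarrow> c x + m \<le> c y"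
proof -
  obtain xs where "xs \<noteq> []" "hd xs = x" "last xs = y" "successively (\<lambda>x y. (x, y) \<in> D) xs"
    using rtrancl_imp_distinct_path[OF assms] by blast
  then show ?thesis using potential_path by metis
qed

lemma infinite_normalised_potentials_iff:
  fixes D :: "('a::finite \<times> 'a) set"
  assumes ex: "\<exists>c. potential D w c"
  shows "infinite (normalised_potentials D w) \<longleftrightarrow> D\<^sup>* \<noteq> UNIV"
proof
  assume "infinite (normalised_potentials D w)"
  show "D\<^sup>* \<noteq> UNIV"
  proof
    assume "D\<^sup>* = UNIV"
    then have "\<forall>x y. \<exists>m. \<forall>c. potential D w c \<longrightarrow> c x + m \<le> c y"
      by (intro allI potential_diff_le) simp
    then obtain m where "\<forall>x y. \<forall>c. potential D w c \<longrightarrow> c x + m x y \<le> c y"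
      unfolding choice_iff by blast
    then have m: "potential D w c \<Longrightarrow> c x + m x y \<le> c y" for x y c by simp
    \<comment> \<open>Some vertex has value 0 and no difference exceeds \<open>M\<close>, so all
      values of a normalised solution lie in \<open>{0..M}\<close>.\<close>
    define M where "M = Max (range (\<lambda>(x, y). - m x y))"
    have M: "- m x y \<le> M" for x y unfolding M_def by (rule Max_ge) auto
    have "normalised_potentials D w \<subseteq> PiE UNIV (\<lambda>_. {0..M})"
    proof
      fix c assume c: "c \<in> normalised_potentials D w"
      then have min: "Min (range c) = 0" by (simp add: normalised_potentials_def)
      then obtain y where y: "c y = 0"
        using Min_range_attained[of c] by auto
      have "0 \<le> c x" for x using min Min_le[of "range c" "c x"] by simp
      moreover have "c x \<le> M" for x
        using m[of c x y] M[of x y] y c by (auto simp: normalised_potentials_def)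
      ultimately show "c \<in> PiE UNIV (\<lambda>_. {0..M})" by auto
    qed
    moreover have "finite (PiE (UNIV :: 'a set) (\<lambda>_. {0..M}))" by (intro finite_PiE) auto
    ultimately show False
      using \<open>infinite _\<close> finite_subset by blast
  qed
next
  assume "D\<^sup>* \<noteq> UNIV"
  then obtain K x y where K: "x \<in> K" "y \<notin> K" "\<forall>(i, j)\<in>D. i \<in> K \<longrightarrow> j \<in> K"
    using proper_closed_set by metis
  obtain c where c: "potential D w c" using ex by blast
  define g :: "nat \<Rightarrow> 'a \<Rightarrow> int" where "g t i = c i + (if i \<in> K then int t else 0)" for t i
  have "potential D w (g t)" for t
    using c K(3) by (force simp: potential_def g_def)
  then have "range (\<lambda>t i. g t i - Min (range (g t))) \<subseteq> normalised_potentials D w"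
    using normalise_potential by blast
  \<comment> \<open>Normalising subtracts a constant, so the difference between the values at
    \<open>x\<close> and \<open>y\<close> survives and reveals \<open>t\<close>.\<close>
  moreover have "inj (\<lambda>t i. g t i - Min (range (g t)))"
  proof (rule injI)
    fix t u assume "(\<lambda>i. g t i - Min (range (g t))) = (\<lambda>i. g u i - Min (range (g u)))"
    from fun_cong[OF this, of x] fun_cong[OF this, of y] show "t = u"
      using K by (simp add: g_def)
  qed
  ultimately show "infinite (normalised_potentials D w)"
    using range_inj_infinite finite_subset by blast
qed

lemma more_than_one_normalised_potential_iff:
  fixes D :: "('a::finite \<times> 'a) set"
  assumes ex: "\<exists>c. potential D w c" and "refl D" and w: "\<And>i. w i i = 0"
  shows "more_than_one (normalised_potentials D w) \<longleftrightarrow> (zero_weight_edges D w)\<^sup>* \<noteq> UNIV"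
    (is "_ \<longleftrightarrow> ?E\<^sup>* \<noteq> UNIV")
proof
  assume "more_than_one (normalised_potentials D w)"
  then obtain c c' where c: "c \<in> normalised_potentials D w" "c' \<in> normalised_potentials D w" "c \<noteq> c'"
    by (auto simp: more_than_one_def)
  show "?E\<^sup>* \<noteq> UNIV"
  proof
    assume E: "?E\<^sup>* = UNIV"
    \<comment> \<open>Along a zero-weight edge every solution grows by exactly \<open>w\<close>, so
      two solutions have equal differences along paths of such edges.\<close>
    have "c y - c x = c' y - c' x" if "(x, y) \<in> ?E\<^sup>*" for x y
      using that
    proof (induction rule: rtrancl_induct)
      case (step y z)
      have "c z = c y + w y z" "c' z = c' y + w y z"
        using c potential_tight[OF _ step(2), of c] potential_tight[OF _ step(2), of c']
        by (simp_all only: normalised_potentials_def mem_Collect_eq)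
      then show ?case using step.IH by linarith
    qed auto
    then have "c = c'"
      using E c by (intro normalised_potential_eqI) (auto simp: normalised_potentials_def)
    then show False using c by simp
  qed
next
  assume E: "?E\<^sup>* \<noteq> UNIV"
  obtain c where c: "potential D w c" using ex by blast
  \<comment> \<open>If the tight edges connected everything, each would lie on a tight cycle and
    hence belong to \<open>?E\<close>, making \<open>?E\<close> strongly connected too.\<close>
  have "(tight_edges D w c)\<^sup>* \<noteq> UNIV"
  proof
    assume T: "(tight_edges D w c)\<^sup>* = UNIV"
    then have "tight_edges D w c \<subseteq> ?E"
      using tight_cycle_zero_weight[OF assms(2), of w _ _ c] w by auto
    then show False using rtrancl_mono T E by blast
  qed
  then obtain K x y where K: "x \<in> K" "y \<notin> K" "\<forall>(i, j)\<in>tight_edges D w c. i \<in> K \<longrightarrow> j \<in> K"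
    using proper_closed_set by metis
  \<comment> \<open>Integrality enters here: an edge of \<open>D\<close> leaving \<open>K\<close> is
    not tight, so it has slack at least 1, which absorbs the raise.\<close>
  define c' where "c' i = c i + (if i \<in> K then 1 else 0)" for i
  have "potential D w c'"
    unfolding potential_def
  proof clarify
    fix i j assume "(i, j) \<in> D"
    moreover from this have "c i + w i j \<le> c j" using c by (auto simp: potential_def)
    moreover have "c j \<noteq> c i + w i j \<or> (i \<in> K \<longrightarrow> j \<in> K)"
      using K(3) \<open>(i, j) \<in> D\<close> by (auto simp: tight_edges_def)
    ultimately show "c' i + w i j \<le> c' j" by (auto simp: c'_def)
  qed
  note this[THEN normalise_potential] c[THEN normalise_potential]
  moreover have "(\<lambda>i. c i - Min (range c)) \<noteq> (\<lambda>i. c' i - Min (range c'))"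
  proof
    assume "(\<lambda>i. c i - Min (range c)) = (\<lambda>i. c' i - Min (range c'))"
    from fun_cong[OF this, of x] fun_cong[OF this, of y] show False
      using K by (simp add: c'_def)
  qed
  ultimately show "more_than_one (normalised_potentials D w)"
    unfolding more_than_one_def by blast
qed

subsection \<open>Block-triangular forms and strong components\<close>

definition row_digraph :: "('a \<Rightarrow> 'b) \<Rightarrow> ('a \<times> 'b) set \<Rightarrow> ('a \<times> 'a) set" where
  "row_digraph \<pi> A = {(i, i'). (i, \<pi> i') \<in> A}"

definition mutually_reachable :: "('a \<times> 'a) set \<Rightarrow> ('a \<times> 'a) set" where
  "mutually_reachable D = D\<^sup>* \<inter> (D\<^sup>*)\<inverse>"

lemma equiv_mutually_reachable: "equiv UNIV (mutually_reachable D)"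
  by (rule equivI) (auto simp: mutually_reachable_def refl_on_def sym_def intro!: transI)

text \<open>Counting classes becomes a question about single unrelated pairs.\<close>

lemma more_than_one_quotient_iff:
  assumes "equiv V r"
  shows "more_than_one (V // r) \<longleftrightarrow> (\<exists>u\<in>V. \<exists>v\<in>V. (u, v) \<notin> r)"
  using eq_equiv_class_iff[OF assms] unfolding more_than_one_def quotient_def by auto

lemma more_than_one_image_iff: "inj_on f X \<Longrightarrow> more_than_one (f ` X) \<longleftrightarrow> more_than_one X"
  by (simp add: more_than_one_def inj_on_def) metis

section \<open>Block positions as a partition of the indices\<close>

lemma sum_list_take_mono: "k \<le> l \<Longrightarrow> sum_list (take k N) \<le> sum_list (take l (N :: nat list))"
  by (metis le_add1 le_add_diff_inverse sum_list_append take_add)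

lemma block_positions_cover:
  assumes "p \<in> {1..sum_list N}"
  shows "\<exists>k<length N. p \<in> block_positions N k"
  using assms
proof (induction N rule: rev_induct)
  case (snoc m N)
  show ?case
  proof (cases "p \<le> sum_list N")
    case True
    then obtain k where "k < length N" "p \<in> block_positions N k" using snoc by auto
    then show ?thesis by (intro exI[of _ k]) (auto simp: block_positions_def)
  next
    case False
    then show ?thesis using snoc.prems
      by (intro exI[of _ "length N"]) (auto simp: block_positions_def)
  qed
qed auto

lemma block_positions_subset: "block_positions N l \<subseteq> {1..sum_list N}"
  \<comment> \<open>\<open>l\<close> may lie beyond the end of the list; taking
    \<open>max (Suc l) (length N)\<close> entries always yields all of \<open>N\<close>.\<close>
  using sum_list_take_mono[of "Suc l" "max (Suc l) (length N)" N] by (auto simp: block_positions_def)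

lemma block_positions_disjoint:
  assumes "k \<noteq> l"
  shows "block_positions N k \<inter> block_positions N l = {}"
  using assms sum_list_take_mono[of "Suc k" l N] sum_list_take_mono[of "Suc l" k N]
  by (cases k l rule: linorder_cases) (auto simp: block_positions_def)

lemma block_positions_nonempty:
  assumes "l < length N" "\<forall>m\<in>set N. m > 0"
  shows "block_positions N l \<noteq> {}"
proof -
  have "sum_list (take (Suc l) N) \<in> block_positions N l"
    using assms by (auto simp: block_positions_def take_Suc_conv_app_nth)
  then show ?thesis by auto
qed

lemma square_block_form_cover:
  assumes "square_block_form R C \<rho> \<kappa> N"
  shows "R = (\<Union>l<length N. \<rho> ` block_positions N l)" "C = (\<Union>l<length N. \<kappa> ` block_positions N l)"
proof -
  have "{1..sum_list N} = (\<Union>l<length N. block_positions N l)"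
    using block_positions_cover[of _ N] block_positions_subset[of N] by blast
  then show "R = (\<Union>l<length N. \<rho> ` block_positions N l)" "C = (\<Union>l<length N. \<kappa> ` block_positions N l)"
    using assms unfolding square_block_form_def bij_betw_def by (metis image_UN)+
qed

lemma square_block_form_disjoint:
  assumes "square_block_form R C \<rho> \<kappa> N" "k \<noteq> l"
  shows "\<rho> ` block_positions N k \<inter> \<rho> ` block_positions N l = {}"
proof -
  have "inj_on \<rho> {1..sum_list N}"
    using assms by (auto simp: square_block_form_def bij_betw_def)
  then show ?thesis
    using inj_on_image_Int[of \<rho> "{1..sum_list N}" "block_positions N k" "block_positions N l"]
      block_positions_subset[of N] block_positions_disjoint[OF assms(2), of N] by auto
qed

text \<open>
  Everything from the \<open>l\<close>-th diagonal block on is mapped into itself by the transversal, hence onto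
  itself since row and column counts agree.
\<close>

lemma btf_transversal_blocks:
  assumes form: "square_block_form R C \<rho> \<kappa> N" and btf: "puts_into_btf A \<rho> \<kappa> N"
    and \<pi>: "bij_betw \<pi> R C" "\<And>i. i \<in> R \<Longrightarrow> (i, \<pi> i) \<in> A" and l: "l < length N"
  shows "\<pi> ` \<rho> ` block_positions N l = \<kappa> ` block_positions N l"
proof -
  \<comment> \<open>The tail of positions belonging to block \<open>l\<close> and all later
    blocks.\<close>
  define P where "P l = {sum_list (take l N)<..sum_list N}" for l
  have P: "P l \<subseteq> {1..sum_list N}" for l by (auto simp: P_def)
  have \<rho>: "inj_on \<rho> {1..sum_list N}" "\<rho> ` {1..sum_list N} = R"
    and \<kappa>: "inj_on \<kappa> {1..sum_list N}" "\<kappa> ` {1..sum_list N} = C"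
    using form by (auto simp: square_block_form_def bij_betw_def)
  have inj: "inj_on (\<pi> \<circ> \<rho>) {1..sum_list N}"
    using \<rho> \<pi>(1) by (auto simp: bij_betw_def intro: comp_inj_on)
  have tail: "\<pi> ` \<rho> ` P l = \<kappa> ` P l" for l
  proof (rule card_subset_eq)
    show "finite (\<kappa> ` P l)" by (auto simp: P_def)
    show "\<pi> ` \<rho> ` P l \<subseteq> \<kappa> ` P l"
    proof
      fix j assume "j \<in> \<pi> ` \<rho> ` P l"
      then obtain p where p: "p \<in> P l" "j = \<pi> (\<rho> p)" by auto
      then have "\<rho> p \<in> R" using P \<rho>(2) by blast
      then have "j \<in> C" "(\<rho> p, j) \<in> A" using \<pi> p by (auto simp: bij_betw_def)
      then obtain q where q: "q \<in> {1..sum_list N}" "j = \<kappa> q" using \<kappa>(2) by auto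
      obtain k where k: "k < length N" "p \<in> block_positions N k"
        using block_positions_cover p(1) P by blast
      obtain m where m: "m < length N" "q \<in> block_positions N m"
        using block_positions_cover q(1) by blast
      \<comment> \<open>An entry cannot lie in a column block before its row block, so the column
        stays in the tail that contains the row.\<close>
      have "k \<le> m"
        using btf k m q \<open>(\<rho> p, j) \<in> A\<close> by (force simp: puts_into_btf_def not_le[symmetric])
      moreover have "l \<le> k"
        using k(2) p(1) sum_list_take_mono[of "Suc k" l N]
        by (force simp: block_positions_def P_def not_less_eq_eq[symmetric])
      ultimately have "q \<in> P l"
        using m(2) q(1) sum_list_take_mono[of l m N] by (auto simp: block_positions_def P_def)
      then show "j \<in> \<kappa> ` P l" using q by blast
    qed
    have "card (\<pi> ` \<rho> ` P l) = card (P l)"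
      using card_image[OF inj_on_subset[OF inj P]] by (simp add: image_comp)
    moreover have "card (\<kappa> ` P l) = card (P l)"
      using card_image[OF inj_on_subset[OF \<kappa>(1) P]] .
    ultimately show "card (\<pi> ` \<rho> ` P l) = card (\<kappa> ` P l)" by simp
  qed
  \<comment> \<open>A single block is the difference of two successive tails, and injective maps
    respect differences.\<close>
  have bp: "block_positions N l = P l - P (Suc l)"
    using sum_list_take_mono[of "Suc l" "length N" N] l
    by (auto simp: block_positions_def P_def)
  have "(\<pi> \<circ> \<rho>) ` (P l - P (Suc l)) = (\<pi> \<circ> \<rho>) ` P l - (\<pi> \<circ> \<rho>) ` P (Suc l)"
    using inj_on_image_set_diff[OF inj, of "P l" "P (Suc l)"] P by blast
  also have "\<dots> = \<kappa> ` P l - \<kappa> ` P (Suc l)"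
    using tail[of l] tail[of "Suc l"] by (simp add: image_comp)
  also have "\<dots> = \<kappa> ` (P l - P (Suc l))"
    using inj_on_image_set_diff[OF \<kappa>(1), of "P l" "P (Suc l)"] P by blast
  finally show ?thesis by (simp add: bp image_comp)
qed

text \<open>The column \<open>\<pi> y\<close> lies in the column block with the same index as the
  row block of \<open>y\<close>, so an edge backwards would be an entry below the diagonal
  blocks.\<close>

lemma btf_edge_le:
  assumes "square_block_form R C \<rho> \<kappa> N" "puts_into_btf A \<rho> \<kappa> N"
    "bij_betw \<pi> R C" "\<And>i. i \<in> R \<Longrightarrow> (i, \<pi> i) \<in> A"
    and "k < length N" "l < length N" "x \<in> \<rho> ` block_positions N k" "y \<in> \<rho> ` block_positions N l"
    and "(x, y) \<in> row_digraph \<pi> A"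
  shows "k \<le> l"
proof (rule ccontr)
  assume "\<not> k \<le> l"
  have "\<pi> y \<in> \<kappa> ` block_positions N l"
    using btf_transversal_blocks[OF assms(1-4) \<open>l < length N\<close>] assms(8) by blast
  then have "(x, \<pi> y) \<in> A \<inter> (\<rho> ` block_positions N k \<times> \<kappa> ` block_positions N l)"
    using assms(7,9) by (simp add: row_digraph_def)
  moreover have "A \<inter> (\<rho> ` block_positions N k \<times> \<kappa> ` block_positions N l) = {}"
    using assms(2,5,6) \<open>\<not> k \<le> l\<close> by (simp add: puts_into_btf_def)
  ultimately show False by blast
qed

text \<open>The sets are laid out one after another: the induction appends an enumeration of the
  last set, shifted past the \<open>n\<close> positions already used.\<close>

lemma exists_block_enumeration:
  assumes "\<And>K. K \<in> set Ks \<Longrightarrow> finite K" "sorted_wrt (\<lambda>X Y. X \<inter> Y = {}) Ks"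
  shows "\<exists>\<rho>. bij_betw \<rho> {1..sum_list (map card Ks)} (\<Union>(set Ks)) \<and>
           (\<forall>l<length Ks. \<rho> ` block_positions (map card Ks) l = Ks ! l)"
  using assms
proof (induction Ks rule: rev_induct)
  case Nil
  then show ?case by (auto simp: bij_betw_def)
next
  case (snoc K Ks)
  define n where "n = sum_list (map card Ks)"
  obtain \<rho> where \<rho>: "bij_betw \<rho> {1..n} (\<Union>(set Ks))"
    "\<And>l. l < length Ks \<Longrightarrow> \<rho> ` block_positions (map card Ks) l = Ks ! l"
    using snoc by (auto simp: sorted_wrt_append n_def)
  have "\<exists>g. bij_betw g {n + 1..n + card K} K"
    using snoc.prems(1) by (intro finite_same_card_bij) auto
  then obtain g where g: "bij_betw g {n + 1..n + card K} K" by blast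
  define h where "h i = (if i \<le> n then \<rho> i else g i)" for i
  have h\<rho>: "h ` X = \<rho> ` X" if "X \<subseteq> {1..n}" for X
    using that by (intro image_cong) (auto simp: h_def)
  have hg: "h ` {n + 1..n + card K} = K"
    using g by (auto simp: h_def bij_betw_def image_iff)
  have "bij_betw h {1..n} (\<Union>(set Ks))"
    using \<rho>(1) by (rule bij_betw_cong[THEN iffD1, rotated]) (auto simp: h_def)
  moreover have "bij_betw h {n + 1..n + card K} K"
    using g by (rule bij_betw_cong[THEN iffD1, rotated]) (auto simp: h_def)
  ultimately have "bij_betw h ({1..n} \<union> {n + 1..n + card K}) (\<Union>(set Ks) \<union> K)"
    using snoc.prems(2) by (intro bij_betw_combine) (auto simp: sorted_wrt_append)
  moreover have "{1..n} \<union> {n + 1..n + card K} = {1..sum_list (map card (Ks @ [K]))}"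
    by (auto simp: n_def)
  moreover have "h ` block_positions (map card (Ks @ [K])) l = (Ks @ [K]) ! l"
    if "l < length (Ks @ [K])" for l
  proof (cases "l < length Ks")
    case True
    then have "block_positions (map card (Ks @ [K])) l = block_positions (map card Ks) l"
      by (simp add: block_positions_def)
    then show ?thesis
      using True \<rho>(2) h\<rho>[OF block_positions_subset[of "map card Ks" l, folded n_def]]
      by (simp add: nth_append)
  next
    case False
    then have "l = length Ks" using that by simp
    then have "block_positions (map card (Ks @ [K])) l = {n + 1..n + card K}"
      by (auto simp: block_positions_def n_def)
    then show ?thesis using \<open>l = length Ks\<close> hg by simp
  qed
  ultimately show ?case by (intro exI[of _ h]) (auto simp: Un_commute)
qed

text \<open>Numbering the columns by \<open>\<pi> \<circ> \<rho>\<close> makes each column block the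
  image of its row block, so entries below the diagonal blocks are exactly the edges from a later
  set to an earlier one.\<close>

lemma exists_btf_of_ordered_partition:
  assumes "finite R" "bij_betw \<pi> R C" "\<Union>(set Ks) = R" "{} \<notin> set Ks"
    and disj: "sorted_wrt (\<lambda>X Y. X \<inter> Y = {}) Ks"
    and edges: "sorted_wrt (\<lambda>X Y. row_digraph \<pi> A \<inter> (Y \<times> X) = {}) Ks"
  shows "\<exists>\<rho>. square_block_form R C \<rho> (\<pi> \<circ> \<rho>) (map card Ks) \<and> puts_into_btf A \<rho> (\<pi> \<circ> \<rho>) (map card Ks) \<and>
           (\<forall>l<length Ks. \<rho> ` block_positions (map card Ks) l = Ks ! l)"
proof -
  have fin: "finite K" if "K \<in> set Ks" for K
    using that assms(1,3) by (metis Union_upper finite_subset)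
  obtain \<rho> where \<rho>: "bij_betw \<rho> {1..sum_list (map card Ks)} R"
    and bl: "\<And>l. l < length Ks \<Longrightarrow> \<rho> ` block_positions (map card Ks) l = Ks ! l"
    using exists_block_enumeration[OF fin disj] assms(3) by auto
  have "square_block_form R C \<rho> (\<pi> \<circ> \<rho>) (map card Ks)"
    using \<rho> bij_betw_trans[OF \<rho> assms(2)] fin assms(4)
    by (auto simp: square_block_form_def card_gt_0_iff)
  moreover have "puts_into_btf A \<rho> (\<pi> \<circ> \<rho>) (map card Ks)"
    unfolding puts_into_btf_def
  proof clarsimp
    fix k l assume kl: "k < length Ks" "l < k"
    then have "row_digraph \<pi> A \<inter> (Ks ! k \<times> Ks ! l) = {}"
      using edges by (auto simp: sorted_wrt_iff_nth_less)
    moreover have "(\<pi> \<circ> \<rho>) ` block_positions (map card Ks) l = \<pi> ` (Ks ! l)"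
      using bl[of l] kl by (metis image_comp less_trans)
    ultimately show "A \<inter> \<rho> ` block_positions (map card Ks) k \<times>
        (\<lambda>x. \<pi> (\<rho> x)) ` block_positions (map card Ks) l = {}"
      using bl[OF kl(1)] by (auto simp: row_digraph_def comp_def)
  qed
  ultimately show ?thesis using bl by blast
qed

text \<open>Edges never lead to an earlier block of a block-triangular form. Hence strong
  connectivity allows only one block, and without it a proper reachable set can be split off as the
  last block.\<close>

lemma irreducible_pattern_iff:
  assumes "finite R" and \<pi>: "bij_betw \<pi> R C" "\<And>i. i \<in> R \<Longrightarrow> (i, \<pi> i) \<in> A"
  shows "irreducible_pattern R C A \<longleftrightarrow> R \<times> R \<subseteq> (Restr (row_digraph \<pi> A) R)\<^sup>*" (is "_ \<longleftrightarrow> _ \<subseteq> ?D\<^sup>*")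
proof
  assume irr: "irreducible_pattern R C A"
  show "R \<times> R \<subseteq> ?D\<^sup>*"
  proof (rule ccontr)
    assume "\<not> R \<times> R \<subseteq> ?D\<^sup>*"
    then obtain x y where xy: "x \<in> R" "y \<in> R" "(x, y) \<notin> ?D\<^sup>*" by auto
    define K where "K = ?D\<^sup>* `` {x}"
    have K: "x \<in> K" "y \<notin> K" using xy by (auto simp: K_def)
    have "K \<subseteq> R"
      using xy(1) by (auto simp: K_def elim: rtranclE)
    moreover have "row_digraph \<pi> A \<inter> (K \<times> (R - K)) = {}"
      using \<open>K \<subseteq> R\<close> by (auto simp: K_def intro: rtrancl_into_rtrancl)
    ultimately obtain \<rho> where "square_block_form R C \<rho> (\<pi> \<circ> \<rho>) (map card [R - K, K])"
      "puts_into_btf A \<rho> (\<pi> \<circ> \<rho>) (map card [R - K, K])"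
      using exists_btf_of_ordered_partition[OF assms(1,2), of "[R - K, K]" A] xy K by auto
    moreover have "length (map card [R - K, K]) > 1" by simp
    ultimately show False using irr unfolding irreducible_pattern_def by blast
  qed
next
  assume conn: "R \<times> R \<subseteq> ?D\<^sup>*"
  have "transversal R C ((\<lambda>i. (i, \<pi> i)) ` R)"
    using \<pi>(1) by (auto simp: transversal_def bij_betw_def inj_on_def)
  moreover have "(\<lambda>i. (i, \<pi> i)) ` R \<subseteq> A" using \<pi>(2) by auto
  ultimately have "\<exists>T\<subseteq>A. transversal R C T" by metis
  moreover have False if form: "square_block_form R C \<rho> \<kappa> N" and N: "length N > 1"
    and btf: "puts_into_btf A \<rho> \<kappa> N" for \<rho> \<kappa> N
  proof -
    let ?b = "\<lambda>l. \<rho> ` block_positions N l"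
    have ne: "?b l \<noteq> {}" "?b l \<subseteq> R" if "l < length N" for l
      using form that block_positions_nonempty[of l N] square_block_form_cover(1)[OF form]
      by (auto simp: square_block_form_def)
    have "length N - 1 < length N" "0 < length N" using N by auto
    from this[THEN ne(1)] obtain x y where "x \<in> ?b (length N - 1)" "y \<in> ?b 0" by blast
    with ne(2)[OF \<open>length N - 1 < length N\<close>] ne(2)[OF \<open>0 < length N\<close>]
    have x: "x \<in> ?b (length N - 1)" "x \<in> R" and y: "y \<in> ?b 0" "y \<in> R" by blast+
    \<comment> \<open>Nothing comes after the last block, so paths starting there stay in
      it.\<close>
    have "z \<in> ?b (length N - 1)" if "(x, z) \<in> ?D\<^sup>*" for z
      using that
    proof (induction rule: rtrancl_induct)
      case (step u v)
      then obtain m where m: "m < length N" "v \<in> ?b m"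
        using square_block_form_cover(1)[OF form] by auto
      then have "length N - 1 \<le> m"
        using btf_edge_le[OF form btf \<pi>, of "length N - 1" m u v] step N by auto
      then have "m = length N - 1" using m by simp
      then show ?case using m by simp
    qed (use x in auto)
    then have "y \<in> ?b (length N - 1)" using conn x y by auto
    moreover have "length N - 1 \<noteq> 0" using N by simp
    ultimately show False using y square_block_form_disjoint[OF form, of "length N - 1" 0] by auto
  qed
  ultimately show "irreducible_pattern R C A"
    unfolding irreducible_pattern_def by blast
qed

text \<open>Entries outside the diagonal block are invisible to the digraph restricted to its rows,
  since \<open>\<pi>\<close> sends these rows into \<open>C\<close>.\<close>

lemma block_irreducible_iff:
  assumes "finite R" and \<pi>: "bij_betw \<pi> R C" "\<And>i. i \<in> R \<Longrightarrow> (i, \<pi> i) \<in> A"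
  shows "irreducible_pattern R C (A \<inter> (R \<times> C)) \<longleftrightarrow> R \<times> R \<subseteq> (Restr (row_digraph \<pi> A) R)\<^sup>*"
proof -
  have "Restr (row_digraph \<pi> (A \<inter> (R \<times> C))) R = Restr (row_digraph \<pi> A) R"
    using \<pi>(1) by (auto simp: row_digraph_def bij_betw_def)
  then show ?thesis
    using irreducible_pattern_iff[of R \<pi> C "A \<inter> (R \<times> C)"] assms by (auto simp: bij_betw_def)
qed

text \<open>Each vertex on a path from \<open>x\<close> to \<open>y\<close> leads on to
  \<open>y\<close> and from there back to \<open>x\<close>, so the path never leaves the
  class.\<close>

lemma mutually_reachable_Restr:
  assumes "(x, y) \<in> mutually_reachable D"
  shows "(x, y) \<in> (Restr D (mutually_reachable D `` {x}))\<^sup>*"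
proof -
  have xy: "(x, y) \<in> D\<^sup>*" "(y, x) \<in> D\<^sup>*" using assms by (auto simp: mutually_reachable_def)
  then show ?thesis
  proof (induction rule: rtrancl_induct)
    case (step u v)
    have "(u, x) \<in> D\<^sup>*" using step by (meson converse_rtrancl_into_rtrancl)
    then have "(u, v) \<in> Restr D (mutually_reachable D `` {x})"
      using step by (auto simp: mutually_reachable_def intro: rtrancl_into_rtrancl)
    then show ?case using step \<open>(u, x) \<in> D\<^sup>*\<close> by (meson rtrancl_into_rtrancl)
  qed auto
qed

lemma quotient_mutually_reachable_strong:
  assumes "K \<in> UNIV // mutually_reachable D"
  shows "K \<times> K \<subseteq> (Restr D K)\<^sup>*"
proof clarify
  fix x y assume "x \<in> K" "y \<in> K"
  then have "(x, y) \<in> mutually_reachable D"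
    using quotient_eq_iff[OF equiv_mutually_reachable assms assms] by blast
  moreover have "K = mutually_reachable D `` {x}"
    using \<open>x \<in> K\<close> assms equiv_mutually_reachable[of D]
    by (metis Image_singleton_iff equiv_class_eq quotientE)
  ultimately show "(x, y) \<in> (Restr D K)\<^sup>*" using mutually_reachable_Restr by metis
qed

text \<open>Irreducibility connects each row block strongly, and the block order rules out cycles
  through several blocks; so the row blocks are the strong components. The right-hand side does not
  mention the form, which gives uniqueness.\<close>

lemma irreducible_btf_emblem:
  fixes \<pi> :: "'n::finite \<Rightarrow> 'n"
  assumes \<pi>: "bij \<pi>" "\<And>i. (i, \<pi> i) \<in> A" and irr: "irreducible_btf A \<rho> \<kappa> N"
  shows "emblem \<rho> \<kappa> N = (\<lambda>K. (K, \<pi> ` K)) ` (UNIV // mutually_reachable (row_digraph \<pi> A))"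
proof -
  let ?D = "row_digraph \<pi> A"
  let ?b = "\<lambda>l. \<rho> ` block_positions N l"
  have form: "square_block_form UNIV UNIV \<rho> \<kappa> N" and btf: "puts_into_btf A \<rho> \<kappa> N"
    using irr by (auto simp: irreducible_btf_def)
  note \<pi>b = btf_transversal_blocks[OF form btf \<pi>]
  have strong: "?b l \<times> ?b l \<subseteq> ?D\<^sup>*" if l: "l < length N" for l
  proof -
    have "irreducible_pattern (?b l) (\<pi> ` ?b l) (A \<inter> (?b l \<times> \<pi> ` ?b l))"
      using irr l \<pi>b[OF l] by (auto simp: irreducible_btf_def Let_def)
    moreover have "bij_betw \<pi> (?b l) (\<pi> ` ?b l)"
      using \<pi>(1) by (meson bij_betw_subset subset_UNIV)
    ultimately have "?b l \<times> ?b l \<subseteq> (Restr ?D (?b l))\<^sup>*"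
      using block_irreducible_iff[of "?b l" \<pi> "\<pi> ` ?b l" A] \<pi>(2) by auto
    also have "\<dots> \<subseteq> ?D\<^sup>*" by (intro rtrancl_mono) auto
    finally show ?thesis .
  qed
  \<comment> \<open>A path can only increase the block index, so mutually reachable rows share a
    block.\<close>
  have le: "k \<le> l" if "(x, y) \<in> ?D\<^sup>*" "k < length N" "l < length N" "x \<in> ?b k" "y \<in> ?b l" for x y k l
    using that
  proof (induction arbitrary: l rule: rtrancl_induct)
    case base
    then show ?case using square_block_form_disjoint[OF form, of k l] by auto
  next
    case (step u v)
    obtain m where m: "m < length N" "u \<in> ?b m"
      using square_block_form_cover(1)[OF form] by blast
    then have "k \<le> m" using step by blast
    also have "m \<le> l" using btf_edge_le[OF form btf \<pi> m(1) _ m(2)] step by blast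
    finally show ?case .
  qed
  have cls: "mutually_reachable ?D `` {x} = ?b l" if l: "l < length N" "x \<in> ?b l" for x l
  proof
    show "?b l \<subseteq> mutually_reachable ?D `` {x}"
      using strong[OF l(1)] l(2) by (auto simp: mutually_reachable_def)
    show "mutually_reachable ?D `` {x} \<subseteq> ?b l"
    proof
      fix y assume "y \<in> mutually_reachable ?D `` {x}"
      then have xy: "(x, y) \<in> ?D\<^sup>*" "(y, x) \<in> ?D\<^sup>*" by (auto simp: mutually_reachable_def)
      obtain m where m: "m < length N" "y \<in> ?b m"
        using square_block_form_cover(1)[OF form] by blast
      then show "y \<in> ?b l" using le[OF xy(1)] le[OF xy(2)] l by (metis le_antisym)
    qed
  qed
  have "?b ` {..<length N} = UNIV // mutually_reachable ?D"
  proof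
    show "?b ` {..<length N} \<subseteq> UNIV // mutually_reachable ?D"
    proof clarify
      fix l assume "l < length N"
      moreover from this obtain x where "x \<in> ?b l"
        using block_positions_nonempty[of l N] form by (auto simp: square_block_form_def)
      ultimately show "?b l \<in> UNIV // mutually_reachable ?D"
        using cls quotientI[of x UNIV] by (metis UNIV_I)
    qed
    show "UNIV // mutually_reachable ?D \<subseteq> ?b ` {..<length N}"
    proof
      fix K assume "K \<in> UNIV // mutually_reachable ?D"
      then obtain x where x: "K = mutually_reachable ?D `` {x}" by (auto elim: quotientE)
      obtain l where "l < length N" "x \<in> ?b l"
        using square_block_form_cover(1)[OF form] by blast
      then show "K \<in> ?b ` {..<length N}" using cls x by blast
    qed
  qed
  then have "(\<lambda>K. (K, \<pi> ` K)) ` (UNIV // mutually_reachable ?D) = (\<lambda>l. (?b l, \<pi> ` ?b l)) ` {..<length N}"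
    by (metis (no_types, lifting) image_cong image_image)
  also have "\<dots> = emblem \<rho> \<kappa> N"
    unfolding emblem_def by (intro image_cong) (auto simp: \<pi>b)
  finally show ?thesis by simp
qed

text \<open>
  Along an edge between different strong components the number of reachable vertices drops, so sorting
  the components by it gives a block-triangular form.
\<close>

lemma exists_irreducible_btf:
  fixes \<pi> :: "'n::finite \<Rightarrow> 'n"
  assumes \<pi>: "bij \<pi>" "\<And>i. (i, \<pi> i) \<in> A"
  shows "\<exists>\<rho> \<kappa> N. irreducible_btf A \<rho> \<kappa> N"
proof -
  let ?D = "row_digraph \<pi> A"
  let ?Q = "UNIV // mutually_reachable ?D"
  \<comment> \<open>The minus sign makes the ascending sort put components with larger reach
    first.\<close>
  define f :: "'n set \<Rightarrow> int" where "f K = - int (card (?D\<^sup>* `` K))" for K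
  have "finite ?Q" by (rule finite)
  then obtain Ks0 where "set Ks0 = ?Q" "distinct Ks0" using finite_distinct_list by blast
  then obtain Ks where Ks: "set Ks = ?Q" "distinct Ks" "sorted (map f Ks)"
    using sorted_sort_key[of f Ks0] by (metis set_sort distinct_sort)
  have disj: "X \<inter> Y = {}" if "X \<in> ?Q" "Y \<in> ?Q" "X \<noteq> Y" for X Y
    using quotient_disj[OF equiv_mutually_reachable that(1,2)] that(3) by blast
  have drop: "f Y < f X \<or> ?D \<inter> (Y \<times> X) = {}" if XY: "X \<in> ?Q" "Y \<in> ?Q" "X \<noteq> Y" for X Y
  proof (rule ccontr)
    assume "\<not> (f Y < f X \<or> ?D \<inter> (Y \<times> X) = {})"
    then obtain x y where xy: "x \<in> X" "y \<in> Y" "(y, x) \<in> ?D" and ge: "f X \<le> f Y" by auto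
    have img: "?D\<^sup>* `` K = ?D\<^sup>* `` {z}" if "K \<in> ?Q" "z \<in> K" for K z
    proof -
      have "(z, u) \<in> ?D\<^sup>*" if "u \<in> K" for u
        using quotient_eq_iff[OF equiv_mutually_reachable \<open>K \<in> ?Q\<close> \<open>K \<in> ?Q\<close> \<open>z \<in> K\<close> that]
        by (simp add: mutually_reachable_def)
      then show ?thesis using that(2) by (auto intro: rtrancl_trans)
    qed
    \<comment> \<open>The edge gives this inclusion. The cardinality bound turns it into equality,
      so \<open>x\<close> reaches \<open>y\<close> and the two components coincide.\<close>
    have "?D\<^sup>* `` {x} \<subseteq> ?D\<^sup>* `` {y}" using xy(3) by (auto intro: converse_rtrancl_into_rtrancl)
    moreover have "card (?D\<^sup>* `` {y}) \<le> card (?D\<^sup>* `` {x})"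
      using ge img[OF XY(1) xy(1)] img[OF XY(2) xy(2)] by (simp add: f_def)
    ultimately have "?D\<^sup>* `` {x} = ?D\<^sup>* `` {y}"
      by (intro card_seteq) auto
    then have "(x, y) \<in> ?D\<^sup>*" by auto
    then have "(y, x) \<in> mutually_reachable ?D" using xy(3) by (auto simp: mutually_reachable_def)
    then have "X = Y"
      using quotient_eq_iff[OF equiv_mutually_reachable XY(2,1) xy(2,1)] by simp
    then show False using XY(3) by simp
  qed
  have nth: "Ks ! k \<in> ?Q" "Ks ! l \<in> ?Q" "Ks ! k \<noteq> Ks ! l" "f (Ks ! k) \<le> f (Ks ! l)"
    if "k < l" "l < length Ks" for k l
  proof -
    show "Ks ! k \<in> ?Q" "Ks ! l \<in> ?Q" using Ks(1) that by (metis nth_mem less_trans)+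
    show "Ks ! k \<noteq> Ks ! l" using Ks(2) that by (simp add: nth_eq_iff_index_eq)
    show "f (Ks ! k) \<le> f (Ks ! l)" using sorted_nth_mono[OF Ks(3), of k l] that by simp
  qed
  have "sorted_wrt (\<lambda>X Y. X \<inter> Y = {}) Ks"
    unfolding sorted_wrt_iff_nth_less using disj[OF nth(1-3)] by blast
  moreover have "sorted_wrt (\<lambda>X Y. ?D \<inter> (Y \<times> X) = {}) Ks"
    unfolding sorted_wrt_iff_nth_less using drop[OF nth(1-3)] nth(4) by (meson not_less)
  moreover have "\<Union>(set Ks) = UNIV" using Ks(1) Union_quotient[OF equiv_mutually_reachable] by metis
  moreover have "{} \<notin> set Ks" using Ks(1) in_quotient_imp_non_empty[OF equiv_mutually_reachable] by blast
  ultimately obtain \<rho> where \<rho>: "square_block_form UNIV UNIV \<rho> (\<pi> \<circ> \<rho>) (map card Ks)"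
    "puts_into_btf A \<rho> (\<pi> \<circ> \<rho>) (map card Ks)"
    "\<And>l. l < length Ks \<Longrightarrow> \<rho> ` block_positions (map card Ks) l = Ks ! l"
    using exists_btf_of_ordered_partition[OF finite \<pi>(1), of Ks A] by auto
  have "irreducible_pattern K (\<pi> ` K) (A \<inter> (K \<times> \<pi> ` K))" if "K \<in> ?Q" for K
    using block_irreducible_iff[of K \<pi> "\<pi> ` K" A] quotient_mutually_reachable_strong[OF that] \<pi>
    by (auto intro: bij_betw_subset[OF \<pi>(1)])
  then have "irreducible_btf A \<rho> (\<pi> \<circ> \<rho>) (map card Ks)"
    using \<rho> Ks(1) unfolding irreducible_btf_def Let_def
    by (metis image_comp length_map nth_mem)
  then show ?thesis by blast
qed

text \<open>Existence and a value common to all irreducible forms are what the definite description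
  needs.\<close>

lemma irreducible_emblem_eq:
  fixes \<pi> :: "'n::finite \<Rightarrow> 'n"
  assumes "bij \<pi>" "\<And>i. (i, \<pi> i) \<in> A"
  shows "irreducible_emblem A = (\<lambda>K. (K, \<pi> ` K)) ` (UNIV // mutually_reachable (row_digraph \<pi> A))"
  unfolding irreducible_emblem_def
proof (rule the_equality)
  obtain \<rho> \<kappa> N where "irreducible_btf A \<rho> \<kappa> N" using exists_irreducible_btf[OF assms] by blast
  then show "\<exists>\<rho> \<kappa> N. irreducible_btf A \<rho> \<kappa> N \<and>
      (\<lambda>K. (K, \<pi> ` K)) ` (UNIV // mutually_reachable (row_digraph \<pi> A)) = emblem \<rho> \<kappa> N"
    using irreducible_btf_emblem[OF assms] by metis
qed (auto simp: irreducible_btf_emblem[OF assms])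

lemma more_than_one_irreducible_emblem_iff:
  fixes \<pi> :: "'n::finite \<Rightarrow> 'n"
  assumes "bij \<pi>" "\<And>i. (i, \<pi> i) \<in> A"
  shows "more_than_one (irreducible_emblem A) \<longleftrightarrow> (row_digraph \<pi> A)\<^sup>* \<noteq> UNIV"
proof -
  have "inj_on (\<lambda>K. (K, \<pi> ` K)) X" for X by (auto simp: inj_on_def)
  then show ?thesis
    unfolding irreducible_emblem_eq[OF assms]
    using more_than_one_quotient_iff[OF equiv_mutually_reachable, of "row_digraph \<pi> A"]
    by (simp add: more_than_one_image_iff) (auto simp: mutually_reachable_def)
qed

subsection \<open>The fine-block graph\<close>

text \<open>The fine-block graph is the digraph of the sparsity pattern with the strong components
  of \<open>E\<close> contracted. As \<open>E\<close> is contained in that digraph, contraction does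
  not change which rows reach which.\<close>

lemma more_than_one_strong_components_iff:
  fixes \<Sigma> :: "ereal ^ 'n::finite ^ 'n"
  assumes blocks: "fine_blocks \<Sigma> = (\<lambda>K. (K, \<pi> ` K)) ` (UNIV // mutually_reachable E)"
    and E: "E \<subseteq> row_digraph \<pi> (sparsity_pattern \<Sigma>)"
  shows "more_than_one (strong_components (fine_block_graph \<Sigma>)) \<longleftrightarrow>
           (row_digraph \<pi> (sparsity_pattern \<Sigma>))\<^sup>* \<noteq> UNIV"
proof -
  let ?D = "row_digraph \<pi> (sparsity_pattern \<Sigma>)" and ?G = "edges (fine_block_graph \<Sigma>)"
  define cls where "cls x = mutually_reachable E `` {x}" for x
  define b where "b x = (cls x, \<pi> ` cls x)" for x
  have V: "vertices (fine_block_graph \<Sigma>) = range b"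
    using blocks by (auto simp: vertices_def fine_block_graph_def b_def cls_def quotient_def)
  have ED: "E\<^sup>* \<subseteq> ?D\<^sup>*" using E by (rule rtrancl_mono)
  have cls: "(x, y) \<in> ?D\<^sup>*" "(y, x) \<in> ?D\<^sup>*" if "y \<in> cls x" for x y
    using that ED by (auto simp: cls_def mutually_reachable_def)
  have self: "x \<in> cls x" for x by (simp add: cls_def mutually_reachable_def)
  \<comment> \<open>Several rows name the same block, so the row \<open>y\<close> representing the
    end block is left arbitrary in the induction.\<close>
  have "(x, y) \<in> ?D\<^sup>*" if "(b x, v) \<in> ?G\<^sup>*" "v = b y" for x y v
    using that
  proof (induction arbitrary: y rule: rtrancl_induct)
    case base
    then show ?case using self[of y] cls(1)[of y x] by (simp add: b_def)
  next
    case (step u v)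
    then obtain z where u: "u = b z"
      by (auto simp: fine_block_graph_def edges_def V[unfolded fine_block_graph_def vertices_def, simplified])
    then obtain i k where "i \<in> cls z" "k \<in> cls y" "(i, \<pi> k) \<in> sparsity_pattern \<Sigma>"
      using step by (auto simp: fine_block_graph_def edges_def b_def)
    then have "(z, i) \<in> ?D\<^sup>*" "(i, k) \<in> ?D" "(k, y) \<in> ?D\<^sup>*"
      using cls by (auto simp: row_digraph_def)
    then have "(z, y) \<in> ?D\<^sup>*" by (meson rtrancl_into_rtrancl rtrancl_trans)
    moreover have "(x, z) \<in> ?D\<^sup>*" using step.IH u by blast
    ultimately show ?case by simp
  qed
  moreover have "(b x, b y) \<in> ?G\<^sup>*" if "(x, y) \<in> ?D\<^sup>*" for x y
    using that
  proof (induction rule: rtrancl_induct)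
    case (step y z)
    \<comment> \<open>The graph has no loops, so an edge inside one block shows up as equality of
      blocks.\<close>
    have "b y = b z \<or> (b y, b z) \<in> ?G"
      using step(2) self[of y] self[of z] V
      by (auto simp: fine_block_graph_def edges_def vertices_def b_def row_digraph_def)
    then show ?case using step by (auto intro: rtrancl_into_rtrancl)
  qed auto
  ultimately have reach: "(b x, b y) \<in> ?G\<^sup>* \<longleftrightarrow> (x, y) \<in> ?D\<^sup>*" for x y by blast
  let ?r = "{(u, v). u \<in> range b \<and> v \<in> range b \<and> (u, v) \<in> ?G\<^sup>* \<and> (v, u) \<in> ?G\<^sup>*}"
  have "equiv (range b) ?r"
    by (rule equivI) (auto simp: refl_on_def sym_def intro!: transI)
  then have "more_than_one (strong_components (fine_block_graph \<Sigma>)) \<longleftrightarrow>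
      (\<exists>u\<in>range b. \<exists>v\<in>range b. (u, v) \<notin> ?r)"
    unfolding strong_components_def V by (rule more_than_one_quotient_iff)
  also have "\<dots> \<longleftrightarrow> (\<exists>x y. (x, y) \<notin> ?D\<^sup>*)"
    by (auto simp: reach)
  finally show ?thesis by auto
qed

subsection \<open>Highest-value transversals and offsets\<close>

text \<open>Exact on the finite entries of a signature matrix, which are natural numbers. At
  \<open>-\<infinity>\<close> it takes the dummy value 0, so it has to be read together with the
  sparsity pattern.\<close>

definition sig_order :: "ereal ^ 'n ^ 'n \<Rightarrow> 'n \<Rightarrow> 'n \<Rightarrow> int" where
  "sig_order \<Sigma> i j = \<lfloor>real_of_ereal (\<Sigma> $ i $ j)\<rfloor>"

lemma sig_entry:
  assumes "signature_matrix \<Sigma>"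
  shows "\<Sigma> $ i $ j = (if (i, j) \<in> sparsity_pattern \<Sigma> then ereal (of_int (sig_order \<Sigma> i j)) else -\<infinity>)"
proof -
  consider "\<Sigma> $ i $ j = -\<infinity>" | k :: nat where "\<Sigma> $ i $ j = ereal (real k)"
    using assms by (auto simp: signature_matrix_def)
  then show ?thesis by cases (auto simp: sparsity_pattern_def sig_order_def)
qed

section \<open>Transversals as bijections\<close>

lemma transversal_UNIV_iff:
  "transversal UNIV UNIV T \<longleftrightarrow> (\<exists>\<pi>. bij \<pi> \<and> T = range (\<lambda>i. (i, \<pi> i)))"
proof
  assume T: "transversal UNIV UNIV T"
  define \<pi> where "\<pi> i = (THE j. (i, j) \<in> T)" for i
  have *: "(i, j) \<in> T \<longleftrightarrow> j = \<pi> i" for i j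
  proof -
    have "\<exists>!j. (i, j) \<in> T" using T by (simp add: transversal_def)
    then show ?thesis unfolding \<pi>_def by (metis theI')
  qed
  moreover have "\<exists>!i. j = \<pi> i" for j
    using T by (simp add: transversal_def *)
  ultimately show "\<exists>\<pi>. bij \<pi> \<and> T = range (\<lambda>i. (i, \<pi> i))"
    by (intro exI[of _ \<pi>]) (auto simp: bij_iff eq_commute)
next
  assume "\<exists>\<pi>. bij \<pi> \<and> T = range (\<lambda>i. (i, \<pi> i))"
  then show "transversal UNIV UNIV T"
    by (auto simp: transversal_def bij_iff image_iff) metis+
qed

text \<open>Finiteness refers to the entries met by the transversal, not to its number of
  positions.\<close>

definition finite_transversals :: "ereal ^ 'n ^ 'n \<Rightarrow> ('n \<Rightarrow> 'n) set" where
  "finite_transversals \<Sigma> = {\<pi>. bij \<pi> \<and> (\<forall>i. (i, \<pi> i) \<in> sparsity_pattern \<Sigma>)}"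

definition highest_finite_transversal :: "ereal ^ 'n::finite ^ 'n \<Rightarrow> ('n \<Rightarrow> 'n) \<Rightarrow> bool" where
  "highest_finite_transversal \<Sigma> \<pi> \<longleftrightarrow> \<pi> \<in> finite_transversals \<Sigma> \<and>
     (\<forall>\<pi>'\<in>finite_transversals \<Sigma>. (\<Sum>i\<in>UNIV. sig_order \<Sigma> i (\<pi>' i)) \<le> (\<Sum>i\<in>UNIV. sig_order \<Sigma> i (\<pi> i)))"

lemma transversal_value_graph:
  fixes \<Sigma> :: "ereal ^ 'n::finite ^ 'n"
  assumes "signature_matrix \<Sigma>"
  shows "transversal_value \<Sigma> (range (\<lambda>i. (i, \<pi> i))) =
    (if \<forall>i. (i, \<pi> i) \<in> sparsity_pattern \<Sigma>
     then ereal (of_int (\<Sum>i\<in>UNIV. sig_order \<Sigma> i (\<pi> i))) else -\<infinity>)"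
proof -
  note entry = sig_entry[OF assms]
  have val: "transversal_value \<Sigma> (range (\<lambda>i. (i, \<pi> i))) = (\<Sum>i\<in>UNIV. \<Sigma> $ i $ \<pi> i)"
    unfolding transversal_value_def by (subst sum.reindex) (auto simp: inj_on_def)
  show ?thesis
  proof (cases "\<forall>i. (i, \<pi> i) \<in> sparsity_pattern \<Sigma>")
    case True
    then have "(\<Sum>i\<in>UNIV. \<Sigma> $ i $ \<pi> i) = (\<Sum>i\<in>UNIV. ereal (of_int (sig_order \<Sigma> i (\<pi> i))))"
      by (intro sum.cong) (auto simp: entry)
    then show ?thesis using True val by simp
  next
    case False
    then obtain i where i: "\<Sigma> $ i $ \<pi> i = -\<infinity>" using entry by metis
    \<comment> \<open>In \<open>ereal\<close> the sum of \<open>\<infinity>\<close> and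
      \<open>-\<infinity>\<close> is \<open>\<infinity>\<close>, so the remaining terms must be
      shown not to reach \<open>\<infinity>\<close>.\<close>
    have "(\<Sum>k\<in>UNIV - {i}. \<Sigma> $ k $ \<pi> k) \<noteq> \<infinity>"
      by (auto simp: sum_Pinfty entry split: if_splits)
    then have "(\<Sum>k\<in>UNIV. \<Sigma> $ k $ \<pi> k) = -\<infinity>"
      by (subst sum.remove[of _ i]) (auto simp: i)
    then show ?thesis using False val by auto
  qed
qed

lemma finite_transversals_nonempty:
  assumes "structurally_well_posed \<Sigma>"
  shows "finite_transversals \<Sigma> \<noteq> {}"
proof -
  obtain \<pi> where "bij \<pi>" and fin: "\<And>i. \<bar>\<Sigma> $ i $ \<pi> i\<bar> \<noteq> \<infinity>"
    using assms by (auto simp: structurally_well_posed_def transversal_UNIV_iff)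
  have "\<Sigma> $ i $ \<pi> i \<noteq> -\<infinity>" for i
    using fin[of i] by auto
  then have "\<pi> \<in> finite_transversals \<Sigma>"
    using \<open>bij \<pi>\<close> by (simp add: finite_transversals_def sparsity_pattern_def)
  then show ?thesis by blast
qed

text \<open>Well-posedness supplies a transversal of finite value, so no maximiser uses an entry
  \<open>-\<infinity>\<close> and the comparison takes place among integers.\<close>

lemma highest_value_transversal_iff:
  fixes \<Sigma> :: "ereal ^ 'n::finite ^ 'n"
  assumes sig: "signature_matrix \<Sigma>" and "structurally_well_posed \<Sigma>"
  shows "highest_value_transversal \<Sigma> T \<longleftrightarrow>
           (\<exists>\<pi>. highest_finite_transversal \<Sigma> \<pi> \<and> T = range (\<lambda>i. (i, \<pi> i)))"
proof
  assume T: "highest_value_transversal \<Sigma> T"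
  then obtain \<pi> where \<pi>: "bij \<pi>" "T = range (\<lambda>i. (i, \<pi> i))"
    by (auto simp: highest_value_transversal_def transversal_UNIV_iff)
  have max: "transversal_value \<Sigma> (range (\<lambda>i. (i, \<pi>' i))) \<le> transversal_value \<Sigma> T" if "bij \<pi>'" for \<pi>'
    using T that by (auto simp: highest_value_transversal_def transversal_UNIV_iff)
  obtain \<pi>0 where \<pi>0: "\<pi>0 \<in> finite_transversals \<Sigma>"
    using finite_transversals_nonempty[OF assms(2)] by blast
  then have fin: "\<forall>i. (i, \<pi> i) \<in> sparsity_pattern \<Sigma>"
    using max[of \<pi>0] unfolding \<pi>(2) transversal_value_graph[OF sig]
    by (auto simp: finite_transversals_def split: if_splits)
  have "(\<Sum>i\<in>UNIV. sig_order \<Sigma> i (\<pi>' i)) \<le> (\<Sum>i\<in>UNIV. sig_order \<Sigma> i (\<pi> i))"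
    if "\<pi>' \<in> finite_transversals \<Sigma>" for \<pi>'
    using max[of \<pi>'] that fin unfolding \<pi>(2) transversal_value_graph[OF sig]
    by (simp add: finite_transversals_def del: of_int_sum)
  then have "highest_finite_transversal \<Sigma> \<pi>"
    using \<pi>(1) fin by (simp add: highest_finite_transversal_def finite_transversals_def)
  then show "\<exists>\<pi>. highest_finite_transversal \<Sigma> \<pi> \<and> T = range (\<lambda>i. (i, \<pi> i))" using \<pi> by blast
next
  assume "\<exists>\<pi>. highest_finite_transversal \<Sigma> \<pi> \<and> T = range (\<lambda>i. (i, \<pi> i))"
  then obtain \<pi> where \<pi>: "highest_finite_transversal \<Sigma> \<pi>" "T = range (\<lambda>i. (i, \<pi> i))" by blast
  have "transversal_value \<Sigma> (range (\<lambda>i. (i, \<pi>' i))) \<le> transversal_value \<Sigma> T" if "bij \<pi>'" for \<pi>'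
    using \<pi>(1) that unfolding \<pi>(2) transversal_value_graph[OF sig]
    by (auto simp: highest_finite_transversal_def finite_transversals_def simp del: of_int_sum)
  then show "highest_value_transversal \<Sigma> T"
    using \<pi> by (auto simp: highest_value_transversal_def transversal_UNIV_iff
        highest_finite_transversal_def finite_transversals_def)
qed

lemma exists_highest_finite_transversal:
  fixes \<Sigma> :: "ereal ^ 'n::finite ^ 'n"
  assumes "structurally_well_posed \<Sigma>"
  shows "\<exists>\<pi>. highest_finite_transversal \<Sigma> \<pi>"
proof -
  let ?f = "\<lambda>\<pi>. \<Sum>i\<in>UNIV. sig_order \<Sigma> i (\<pi> i)"
  have "Max (?f ` finite_transversals \<Sigma>) \<in> ?f ` finite_transversals \<Sigma>"
    using finite_transversals_nonempty[OF assms] by (intro Max_in) auto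
  then obtain \<pi> where \<pi>: "\<pi> \<in> finite_transversals \<Sigma>" "?f \<pi> = Max (?f ` finite_transversals \<Sigma>)"
    by (metis (no_types, lifting) imageE)
  have "?f \<pi>' \<le> ?f \<pi>" if "\<pi>' \<in> finite_transversals \<Sigma>" for \<pi>'
    unfolding \<pi>(2) using that by (intro Max_ge) auto
  then show ?thesis using \<pi>(1) by (auto simp: highest_finite_transversal_def)
qed

text \<open>
  Once \<open>d\<close> is eliminated through \<open>d (\<pi> i) = c i + \<sigma> i (\<pi> i)\<close>, the offset inequalities for \<open>c\<close>
  become difference constraints with these weights.
\<close>

definition offset_weight :: "ereal ^ 'n ^ 'n \<Rightarrow> ('n \<Rightarrow> 'n) \<Rightarrow> 'n \<Rightarrow> 'n \<Rightarrow> int" where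
  "offset_weight \<Sigma> \<pi> i k = sig_order \<Sigma> i (\<pi> k) - sig_order \<Sigma> k (\<pi> k)"

text \<open>The weight of a permutation is the gain in value on passing from \<open>\<pi>\<close> to
  \<open>\<pi> \<circ> \<tau>\<close>; reindexing along \<open>\<tau>\<close> collects the
  subtracted terms into the value of \<open>\<pi>\<close>.\<close>

lemma sum_offset_weight:
  fixes \<Sigma> :: "ereal ^ 'n::finite ^ 'n"
  assumes "bij \<tau>"
  shows "(\<Sum>i\<in>UNIV. offset_weight \<Sigma> \<pi> i (\<tau> i)) =
    (\<Sum>i\<in>UNIV. sig_order \<Sigma> i ((\<pi> \<circ> \<tau>) i)) - (\<Sum>i\<in>UNIV. sig_order \<Sigma> i (\<pi> i))"
  using sum.reindex_bij_betw[OF assms, of "\<lambda>k. sig_order \<Sigma> k (\<pi> k)"]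
  by (simp add: offset_weight_def sum_subtractf)

lemma permutation_in_row_digraph_iff:
  assumes "bij \<pi>"
  shows "permutation_in (row_digraph \<pi> (sparsity_pattern \<Sigma>)) \<tau> \<longleftrightarrow>
    bij \<tau> \<and> \<pi> \<circ> \<tau> \<in> finite_transversals \<Sigma>"
  using bij_comp[OF _ assms] by (auto simp: permutation_in_def finite_transversals_def row_digraph_def)

text \<open>Every finite transversal is \<open>\<pi> \<circ> \<tau>\<close> for a permutation
  \<open>\<tau>\<close> of the rows and exceeds \<open>\<pi>\<close> in value by the weight of
  \<open>\<tau>\<close>, so the highest ones are those of weight 0.\<close>

lemma row_digraph_essential:
  fixes \<Sigma> :: "ereal ^ 'n::finite ^ 'n"
  assumes sig: "signature_matrix \<Sigma>" "structurally_well_posed \<Sigma>"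
    and \<pi>: "highest_finite_transversal \<Sigma> \<pi>"
  shows "row_digraph \<pi> (essential_sparsity_pattern \<Sigma>) =
    zero_weight_edges (row_digraph \<pi> (sparsity_pattern \<Sigma>)) (offset_weight \<Sigma> \<pi>)"
proof -
  have bij: "bij \<pi>" using \<pi> by (auto simp: highest_finite_transversal_def finite_transversals_def)
  have highest: "highest_finite_transversal \<Sigma> (\<pi> \<circ> \<tau>) \<longleftrightarrow>
    permutation_in (row_digraph \<pi> (sparsity_pattern \<Sigma>)) \<tau> \<and>
    (\<Sum>i\<in>UNIV. offset_weight \<Sigma> \<pi> i (\<tau> i)) = 0" if "bij \<tau>" for \<tau>
    using \<pi> that unfolding permutation_in_row_digraph_iff[OF bij] sum_offset_weight[OF that]
    by (force simp: highest_finite_transversal_def)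
  show ?thesis
  proof (intro set_eqI iffI; clarify)
    fix i k assume "(i, k) \<in> row_digraph \<pi> (essential_sparsity_pattern \<Sigma>)"
    then obtain \<pi>' where \<pi>': "highest_finite_transversal \<Sigma> \<pi>'" "\<pi> k = \<pi>' i"
      by (auto simp: row_digraph_def essential_sparsity_pattern_def highest_value_transversal_iff[OF sig])
    define \<tau> where "\<tau> = inv \<pi> \<circ> \<pi>'"
    have "bij \<tau>"
      using bij \<pi>' unfolding \<tau>_def
      by (auto simp: highest_finite_transversal_def finite_transversals_def intro!: bij_comp bij_imp_bij_inv)
    moreover have "\<pi> \<circ> \<tau> = \<pi>'"
      using bij by (auto simp: \<tau>_def fun_eq_iff bij_is_surj surj_f_inv_f)
    moreover have "\<tau> i = k"
      using bij \<pi>'(2) by (simp add: \<tau>_def bij_is_inj flip: \<pi>'(2))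
    ultimately show "(i, k) \<in> zero_weight_edges (row_digraph \<pi> (sparsity_pattern \<Sigma>)) (offset_weight \<Sigma> \<pi>)"
      using highest[of \<tau>] \<pi>'(1) by (auto simp: zero_weight_edges_def)
  next
    fix i k
    assume "(i, k) \<in> zero_weight_edges (row_digraph \<pi> (sparsity_pattern \<Sigma>)) (offset_weight \<Sigma> \<pi>)"
    then obtain \<tau> where "permutation_in (row_digraph \<pi> (sparsity_pattern \<Sigma>)) \<tau>"
      "(\<Sum>i\<in>UNIV. offset_weight \<Sigma> \<pi> i (\<tau> i)) = 0" "k = \<tau> i"
      by (auto simp: zero_weight_edges_def)
    then have "highest_finite_transversal \<Sigma> (\<pi> \<circ> \<tau>)" "k = \<tau> i"
      using highest by (auto simp: permutation_in_def)
    then show "(i, k) \<in> row_digraph \<pi> (essential_sparsity_pattern \<Sigma>)"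
      by (force simp: row_digraph_def essential_sparsity_pattern_def highest_value_transversal_iff[OF sig])
  qed
qed

text \<open>The sum of \<open>d $ j - c $ i\<close> is the same over all transversals. Hence
  tightness on one highest transversal forces it on every other, and the existential over
  transversals gives way to the fixed \<open>\<pi>\<close>.\<close>

lemma normalised_offset_vectors_iff:
  fixes \<Sigma> :: "ereal ^ 'n::finite ^ 'n"
  assumes sig: "signature_matrix \<Sigma>" "structurally_well_posed \<Sigma>"
    and \<pi>: "highest_finite_transversal \<Sigma> \<pi>"
  shows "(c, d) \<in> normalised_offset_vectors \<Sigma> \<longleftrightarrow> Min (range (\<lambda>i. c $ i)) = 0 \<and>
    (\<forall>(i, j)\<in>sparsity_pattern \<Sigma>. sig_order \<Sigma> i j \<le> d $ j - c $ i) \<and>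
    (\<forall>i. d $ \<pi> i - c $ i = sig_order \<Sigma> i (\<pi> i))"
proof -
  let ?S = "sparsity_pattern \<Sigma>" and ?s = "sig_order \<Sigma>"
  have le: "\<Sigma> $ i $ j \<le> ereal (real_of_int m) \<longleftrightarrow> ((i, j) \<in> ?S \<longrightarrow> ?s i j \<le> m)" for i j m
    by (auto simp: sig_entry[OF sig(1)])
  have eq: "ereal (real_of_int m) = \<Sigma> $ i $ j \<longleftrightarrow> m = ?s i j" if "(i, j) \<in> ?S" for i j m
    using that by (auto simp: sig_entry[OF sig(1)])
  have inS: "(i, \<pi>' i) \<in> ?S" if "highest_finite_transversal \<Sigma> \<pi>'" for \<pi>' i
    using that by (auto simp: highest_finite_transversal_def finite_transversals_def)
  have tight: "(\<exists>T. highest_value_transversal \<Sigma> T \<and>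
             (\<forall>(i, j)\<in>T. ereal (real_of_int (d $ j - c $ i)) = \<Sigma> $ i $ j)) \<longleftrightarrow>
      (\<exists>\<pi>'. highest_finite_transversal \<Sigma> \<pi>' \<and> (\<forall>i. d $ \<pi>' i - c $ i = ?s i (\<pi>' i)))"
  proof -
    have "(\<forall>(i, j)\<in>range (\<lambda>i. (i, \<pi>' i)). ereal (real_of_int (d $ j - c $ i)) = \<Sigma> $ i $ j) \<longleftrightarrow>
        (\<forall>i. d $ \<pi>' i - c $ i = ?s i (\<pi>' i))" if "highest_finite_transversal \<Sigma> \<pi>'" for \<pi>'
      using eq[OF inS[OF that]] by (simp del: of_int_diff)
    then have "(\<exists>\<pi>'. highest_finite_transversal \<Sigma> \<pi>' \<and>
          (\<forall>(i, j)\<in>range (\<lambda>i. (i, \<pi>' i)). ereal (real_of_int (d $ j - c $ i)) = \<Sigma> $ i $ j)) \<longleftrightarrow>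
        (\<exists>\<pi>'. highest_finite_transversal \<Sigma> \<pi>' \<and> (\<forall>i. d $ \<pi>' i - c $ i = ?s i (\<pi>' i)))"
      by (intro ex_cong1 conj_cong refl)
    moreover have "(\<exists>T. (\<exists>\<pi>'. P \<pi>' \<and> T = h \<pi>') \<and> Q T) \<longleftrightarrow> (\<exists>\<pi>'. P \<pi>' \<and> Q (h \<pi>'))"
      for P :: "('n \<Rightarrow> 'n) \<Rightarrow> bool" and h :: "('n \<Rightarrow> 'n) \<Rightarrow> ('n \<times> 'n) set" and Q
      by blast
    ultimately show ?thesis unfolding highest_value_transversal_iff[OF sig] by simp
  qed
  have all_tight: "d $ \<pi> i - c $ i = ?s i (\<pi> i)"
    if feas: "\<forall>(i, j)\<in>?S. ?s i j \<le> d $ j - c $ i"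
      and \<pi>': "highest_finite_transversal \<Sigma> \<pi>'" "\<forall>i. d $ \<pi>' i - c $ i = ?s i (\<pi>' i)" for \<pi>' i
  proof -
    have bij: "bij \<pi>" "bij \<pi>'"
      using \<pi> \<pi>' by (auto simp: highest_finite_transversal_def finite_transversals_def)
    have "(\<Sum>i\<in>UNIV. ?s i (\<pi> i)) = (\<Sum>i\<in>UNIV. ?s i (\<pi>' i))"
      using \<pi> \<pi>'(1) by (force simp: highest_finite_transversal_def)
    also have "\<dots> = (\<Sum>i\<in>UNIV. d $ \<pi>' i - c $ i)" using \<pi>'(2) by simp
    also have "\<dots> = (\<Sum>i\<in>UNIV. d $ \<pi> i - c $ i)"
      using sum.reindex_bij_betw[OF bij(1), of "($) d"] sum.reindex_bij_betw[OF bij(2), of "($) d"]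
      by (simp add: sum_subtractf)
    finally have "(\<Sum>i\<in>UNIV. d $ \<pi> i - c $ i - ?s i (\<pi> i)) = 0" by (simp add: sum_subtractf)
    moreover have "0 \<le> d $ \<pi> i - c $ i - ?s i (\<pi> i)" for i
      using feas inS[OF \<pi>, of i] by auto
    ultimately have "d $ \<pi> i - c $ i - ?s i (\<pi> i) = 0"
      by (subst (asm) sum_nonneg_eq_0_iff) auto
    then show ?thesis by simp
  qed
  show ?thesis
    unfolding normalised_offset_vectors_def mem_Collect_eq prod.case tight le
    using all_tight \<pi> by blast
qed

text \<open>Tightness along \<open>\<pi>\<close> recovers \<open>d\<close> from \<open>c\<close>,
  and the remaining inequalities become the difference constraints.\<close>

lemma normalised_offset_vectors_eq:
  fixes \<Sigma> :: "ereal ^ 'n::finite ^ 'n"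
  assumes "signature_matrix \<Sigma>" "structurally_well_posed \<Sigma>"
    and \<pi>: "highest_finite_transversal \<Sigma> \<pi>"
  shows "normalised_offset_vectors \<Sigma> =
    (\<lambda>c. (\<chi> i. c i, \<chi> j. c (inv \<pi> j) + sig_order \<Sigma> (inv \<pi> j) j)) `
      normalised_potentials (row_digraph \<pi> (sparsity_pattern \<Sigma>)) (offset_weight \<Sigma> \<pi>)"
    (is "_ = ?F ` ?NP")
proof (intro set_eqI iffI)
  note iff = normalised_offset_vectors_iff[OF assms]
  have bij: "bij \<pi>" using \<pi> by (auto simp: highest_finite_transversal_def finite_transversals_def)
  then have inv: "inv \<pi> (\<pi> i) = i" "\<pi> (inv \<pi> i) = i" for i
    by (auto simp: bij_is_inj bij_is_surj surj_f_inv_f)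
  fix x
  {
    assume x: "x \<in> normalised_offset_vectors \<Sigma>"
    obtain c d where cd: "x = (c, d)" by fastforce
    note x = x[unfolded cd iff]
    have d: "d $ j = c $ inv \<pi> j + sig_order \<Sigma> (inv \<pi> j) j" for j
      using x inv(2)[of j] by (metis add.commute diff_add_cancel)
    have "($) c \<in> ?NP"
      unfolding normalised_potentials_def potential_def
    proof (intro CollectI conjI; clarsimp?)
      fix i k assume "(i, k) \<in> row_digraph \<pi> (sparsity_pattern \<Sigma>)"
      then have "sig_order \<Sigma> i (\<pi> k) \<le> d $ \<pi> k - c $ i" using x by (auto simp: row_digraph_def)
      then show "c $ i + offset_weight \<Sigma> \<pi> i k \<le> c $ k"
        using d[of "\<pi> k"] by (simp add: offset_weight_def inv)
    qed (use x in auto)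
    moreover have "x = ?F (($) c)" using cd d by (simp add: vec_eq_iff)
    ultimately show "x \<in> ?F ` ?NP" by blast
  }
  {
    assume "x \<in> ?F ` ?NP"
    then obtain c where c: "c \<in> ?NP" "x = ?F c" by blast
    have "sig_order \<Sigma> i j \<le> c (inv \<pi> j) + sig_order \<Sigma> (inv \<pi> j) j - c i"
      if "(i, j) \<in> sparsity_pattern \<Sigma>" for i j
    proof -
      have "(i, inv \<pi> j) \<in> row_digraph \<pi> (sparsity_pattern \<Sigma>)" using that by (simp add: row_digraph_def inv)
      then have "c i + offset_weight \<Sigma> \<pi> i (inv \<pi> j) \<le> c (inv \<pi> j)"
        using c(1) by (auto simp: normalised_potentials_def dest: potentialD)
      then show ?thesis by (simp add: offset_weight_def inv)
    qed
    then show "x \<in> normalised_offset_vectors \<Sigma>"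
      unfolding c(2) iff using c(1) by (auto simp: normalised_potentials_def inv)
  }
qed

theorem theorem5p10:
  fixes \<Sigma> :: "ereal ^ 'n::finite ^ 'n"
  assumes "signature_matrix \<Sigma>"
    and "structurally_well_posed \<Sigma>"
  shows "((more_than_one (normalised_offset_vectors \<Sigma>) \<longleftrightarrow>
            more_than_one (vertices (fine_block_graph \<Sigma>))) \<and>
          (more_than_one (normalised_offset_vectors \<Sigma>) \<longleftrightarrow> fine_block_reducible \<Sigma>)) \<and>
         ((infinite (normalised_offset_vectors \<Sigma>) \<longleftrightarrow>
            more_than_one (strong_components (fine_block_graph \<Sigma>))) \<and>
          (infinite (normalised_offset_vectors \<Sigma>) \<longleftrightarrow> coarse_block_reducible \<Sigma>))"
proof -
  obtain \<pi> where \<pi>: "highest_finite_transversal \<Sigma> \<pi>"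
    using exists_highest_finite_transversal[OF assms(2)] by blast
  let ?S = "sparsity_pattern \<Sigma>" and ?Sess = "essential_sparsity_pattern \<Sigma>"
  let ?D = "row_digraph \<pi> ?S" and ?w = "offset_weight \<Sigma> \<pi>"
  let ?E = "row_digraph \<pi> ?Sess"
  have bij: "bij \<pi>" and inS: "(i, \<pi> i) \<in> ?S" for i
    using \<pi> by (auto simp: highest_finite_transversal_def finite_transversals_def)
  have "refl ?D" using inS by (auto simp: row_digraph_def refl_on_def)
  have w: "?w i i = 0" for i by (simp add: offset_weight_def)
  \<comment> \<open>A permutation of positive weight would turn \<open>\<pi>\<close> into a
    transversal of larger value.\<close>
  have "(\<Sum>i\<in>UNIV. ?w i (\<tau> i)) \<le> 0" if "permutation_in ?D \<tau>" for \<tau>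
    using \<pi> that[unfolded permutation_in_row_digraph_iff[OF bij]]
    by (auto simp: sum_offset_weight highest_finite_transversal_def)
  then have ex: "\<exists>c. potential ?D ?w c"
    using \<open>refl ?D\<close> w by (intro exists_potential)
  have E: "zero_weight_edges ?D ?w = ?E" using row_digraph_essential[OF assms \<pi>] by simp
  \<comment> \<open>\<open>\<pi>\<close> is itself a highest transversal, so the same bijection
    describes the emblems of both patterns.\<close>
  have "(i, \<pi> i) \<in> ?Sess" for i
    using \<pi> by (force simp: essential_sparsity_pattern_def highest_value_transversal_iff[OF assms])
  note ess = bij this
  let ?F = "\<lambda>c. (\<chi> i. c i, \<chi> j. c (inv \<pi> j) + sig_order \<Sigma> (inv \<pi> j) j) :: (int ^ 'n) \<times> (int ^ 'n)"
  \<comment> \<open>The first component returns \<open>c\<close>, so passing from solutions to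
    offset vectors preserves their number.\<close>
  have inj: "inj_on ?F X" for X by (auto simp: inj_on_def vec_eq_iff)
  note offs = normalised_offset_vectors_eq[OF assms \<pi>]
  have fine: "more_than_one (normalised_offset_vectors \<Sigma>) \<longleftrightarrow> ?E\<^sup>* \<noteq> UNIV"
    using more_than_one_normalised_potential_iff[OF ex \<open>refl ?D\<close> w] more_than_one_image_iff[OF inj] E
    unfolding offs by simp
  have coarse: "infinite (normalised_offset_vectors \<Sigma>) \<longleftrightarrow> ?D\<^sup>* \<noteq> UNIV"
    using infinite_normalised_potentials_iff[OF ex] unfolding offs finite_image_iff[OF inj] .
  have "?E \<subseteq> ?D"
    unfolding E[symmetric] by (auto simp: zero_weight_edges_def permutation_in_def)
  then have "more_than_one (strong_components (fine_block_graph \<Sigma>)) \<longleftrightarrow> ?D\<^sup>* \<noteq> UNIV"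
    using irreducible_emblem_eq[OF ess] by (intro more_than_one_strong_components_iff) (auto simp: fine_blocks_def)
  moreover have "more_than_one (vertices (fine_block_graph \<Sigma>)) \<longleftrightarrow> fine_block_reducible \<Sigma>"
    by (simp add: vertices_def fine_block_graph_def fine_block_reducible_def)
  moreover have "fine_block_reducible \<Sigma> \<longleftrightarrow> ?E\<^sup>* \<noteq> UNIV"
    using more_than_one_irreducible_emblem_iff[OF ess] by (simp add: fine_block_reducible_def fine_blocks_def)
  moreover have "coarse_block_reducible \<Sigma> \<longleftrightarrow> ?D\<^sup>* \<noteq> UNIV"
    using more_than_one_irreducible_emblem_iff[OF bij inS] by (simp add: coarse_block_reducible_def coarse_blocks_def)
  ultimately show ?thesis using fine coarse by simp
qed

end
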